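(* Let $F$ be Thompson's group, and let $E_{\mathrm{lo}}(F)$ be the orbit equivalence relation of the conjugation action of $F$ on its space of left-orderings $\mathrm{LO}(F)$. Then $E_{\mathrm{lo}}(F)$ is not smooth.
   Context: Thompson's group is $F=\langle a,b\mid [ab^{-1},a^{-1}ba],[ab^{-1},a^{-2}ba^2]\rangle$; equivalently, $F$ is isomorphic to the group (under composition) of all orientation-preserving piecewise linear homeomorphisms of $[0,1]$ with finitely many breakpoints, all of them dyadic rationals, and whose linear segments have slopes that are integral powers of $2$. A positive cone of a group $G$ is a subset $P\subseteq G$ with $P\cdot P\subseteq P$ and $P\sqcup P^{-1}=G\setminus\{id\}$ (disjoint union). Positive cones correspond to left-orderings (strict total orders $<$ with $g<h\Rightarrow fg<fh$) via $P=\{g: g>id\}$. For a countable group $G$, $\mathrm{LO}(G)\subseteq\{0,1\}^G$ is the set of all positive cones with the subspace topology of the product topology ($\{0,1\}$ discrete); it is a compact Polish space. $G$ acts on $\mathrm{LO}(G)$ by homeomorphisms via $g\cdot P=gPg^{-1}$, and $E_{\mathrm{lo}}(G)$ is the orbit equivalence relation of this action. A Borel equivalence relation $E$ on a Polish space $X$ is smooth if there are a standard Borel space $Y$ and a Borel map $\theta\colon X\to Y$ such that $x_1\mathbin{E}x_2\iff\theta(x_1)=\theta(x_2)$. *)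

theory Defs
  imports "HOL-Analysis.Analysis" "HOL-Algebra.Group_Action"
begin

section \<open>Thompson's group\<close>

text \<open>
  Thompson's group \<open>F\<close> in its model by homeomorphisms of \<open>[0,1]\<close>. The finite set \<open>B\<close> contains the
  breakpoints: between consecutive elements of \<open>B\<close> the map is affine with slope a power of \<open>2\<close>.
  The library's \<open>dyadics\<close> are the nonnegative dyadic rationals, which is enough inside \<open>[0,1]\<close>.
  As in \<open>BijGroup\<close>, maps are extensional outside \<open>[0,1]\<close>, so that equality of group elements is
  equality on \<open>[0,1]\<close>.
\<close>

definition dyadic_piecewise_linear :: "(real \<Rightarrow> real) \<Rightarrow> bool" where
  "dyadic_piecewise_linear f \<longleftrightarrow>
     (\<exists>B. finite B \<and> B \<subseteq> dyadics \<and>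
        (\<forall>x y. 0 \<le> x \<and> x < y \<and> y \<le> 1 \<and> {x<..<y} \<inter> B = {} \<longrightarrow>
           (\<exists>(k::int) c. \<forall>t\<in>{x..y}. f t = 2 powi k * t + c)))"

definition thompson_maps :: "(real \<Rightarrow> real) set" where
  "thompson_maps =
     {f \<in> Bij {0..1}. (\<exists>h. homeomorphism {0..1} {0..1} f h) \<and> strict_mono_on {0..1} f \<and>
        dyadic_piecewise_linear f}"

definition thompson_F :: "(real \<Rightarrow> real) monoid" where
  "thompson_F = BijGroup {0..1} \<lparr>carrier := thompson_maps\<rparr>"


section \<open>The space of left-orderings\<close>

definition positive_cone :: "('a, 'b) monoid_scheme \<Rightarrow> 'a set \<Rightarrow> bool" where
  "positive_cone G P \<longleftrightarrow>
     P \<subseteq> carrier G \<and> P <#>\<^bsub>G\<^esub> P \<subseteq> P \<and>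
     P \<inter> set_inv\<^bsub>G\<^esub> P = {} \<and> P \<union> set_inv\<^bsub>G\<^esub> P = carrier G - {\<one>\<^bsub>G\<^esub>}"

definition LO :: "('a, 'b) monoid_scheme \<Rightarrow> 'a set set" where
  "LO G = {P. positive_cone G P}"

text \<open>
  The subspace topology from \<open>{0,1}\<^sup>G\<close>, where a cone is identified with its characteristic function
  on the carrier of \<open>G\<close>.
\<close>

definition LO_topology :: "('a, 'b) monoid_scheme \<Rightarrow> 'a set topology" where
  "LO_topology G =
     pullback_topology (LO G) (\<lambda>P. \<lambda>g\<in>carrier G. g \<in> P)
       (product_topology (\<lambda>_. discrete_topology (UNIV :: bool set)) (carrier G))"

definition conj_action :: "('a, 'b) monoid_scheme \<Rightarrow> 'a \<Rightarrow> 'a set \<Rightarrow> 'a set" where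
  "conj_action G g = (\<lambda>P\<in>LO G. (g <#\<^bsub>G\<^esub> P) #>\<^bsub>G\<^esub> inv\<^bsub>G\<^esub> g)"

definition E_lo :: "('a, 'b) monoid_scheme \<Rightarrow> 'a set rel" where
  "E_lo G = {(P, Q). P \<in> LO G \<and> Q \<in> LO G \<and> Q \<in> orbit G (conj_action G) P}"


section \<open>Smooth equivalence relations\<close>

definition borel_of :: "'a topology \<Rightarrow> 'a measure" where
  "borel_of X = sigma (topspace X) {U. openin X U}"

definition standard_borel :: "'a measure \<Rightarrow> bool" where
  "standard_borel M \<longleftrightarrow>
     (\<exists>X. completely_metrizable_space X \<and> separable_space X \<and> sets M = sets (borel_of X))"

text \<open>
  HOL cannot quantify over the type of the points of the standard Borel space \<open>Y\<close> inside a formula,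
  so this type is a parameter: \<open>smooth TYPE('y) X E\<close> says that \<open>E\<close> is reducible to equality on some
  standard Borel space with points of type \<open>'y\<close>. Non-smoothness of \<open>E\<close> is \<open>\<not> smooth TYPE('y) X E\<close>
  for an arbitrary type \<open>'y\<close>.
\<close>

definition smooth :: "'y itself \<Rightarrow> 'x topology \<Rightarrow> 'x rel \<Rightarrow> bool" where
  "smooth _ X E \<longleftrightarrow>
     (\<exists>Y :: 'y measure. standard_borel Y \<and>
        (\<exists>\<theta> \<in> borel_of X \<rightarrow>\<^sub>M Y.
           \<forall>x\<in>topspace X. \<forall>y\<in>topspace X. (x, y) \<in> E \<longleftrightarrow> \<theta> x = \<theta> y))"

end

theory Submission
  imports Defs "HOL-Probability.Probability"
begin

text \<open>
  The relation \<open>E\<^sub>0\<close> of eventual equality of binary sequences is not smooth, and it reduces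
  continuously to \<open>E_lo thompson_F\<close>.

  \<^emph>\<open>The reduction.\<close> A sequence of points \<open>x\<close> in \<open>[0,1]\<close> orders \<open>F\<close> lexicographically: \<open>f\<close> is
  positive if it pushes to the right the first \<open>x n\<close> that it moves. Elements that fix all the
  points are compared by the bi-invariant order in which \<open>f\<close> is positive if it pushes points to the
  right just after the largest initial interval on which it is the identity. This gives a positive
  cone \<open>point_cone x\<close>, and conjugation by \<open>h\<close> carries it to \<open>point_cone (h \<circ> x)\<close>. An injective
  sequence of inner points can be recovered from its cone, because an element of \<open>F\<close> can push any
  two given points apart while fixing finitely many others. Put two points \<open>marker n False\<close> and
  \<open>marker n True\<close> in each interval \<open>(1/2^(n+1), 1/2^n)\<close>, and let a binary sequence choose one of them
  for every \<open>n\<close>. Sequences that differ finitely often give conjugate cones, as the two points in an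
  interval are exchanged by an element of \<open>F\<close> supported in that interval. Conversely an element that
  conjugates one cone to the other must carry the first sequence of chosen points to the second.
  Near \<open>0\<close> it is multiplication by a power of \<open>2\<close>, which never carries one marker of an interval to
  the other one, so that the two choices are eventually equal (\<open>E_lo_marked_cone_iff\<close>). The same
  behaviour near \<open>0\<close> makes membership of a given \<open>f\<close> in the cone depend on finitely many choices
  only, which is continuity of the reduction (\<open>continuous_map_marked_cone\<close>).

  \<^emph>\<open>Non-smoothness.\<close> A Borel map that is constant on \<open>E\<^sub>0\<close>-classes is almost everywhere constant
  with respect to fair coin flips, by Kolmogorov's 0-1 law applied to the preimages of a countable
  separating family of open sets. If it also separates classes, a single class has measure \<open>1\<close>,
  although each class is countable and hence null (\<open>not_smooth_if_reduces_E0\<close>).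
\<close>

section \<open>Eventual equality of binary sequences is not smooth\<close>

lemma countable_separating_open_sets:
  assumes "metrizable_space X" "separable_space X"
  obtains \<B> where "countable \<B>" "\<And>U. U \<in> \<B> \<Longrightarrow> openin X U"
    "\<And>x y. x \<in> topspace X \<Longrightarrow> y \<in> topspace X \<Longrightarrow> (\<And>U. U \<in> \<B> \<Longrightarrow> x \<in> U \<longleftrightarrow> y \<in> U) \<Longrightarrow> x = y"
proof -
  obtain M d where M: "Metric_space M d" and X: "X = Metric_space.mtopology M d"
    using assms(1) by (auto simp: metrizable_space_def)
  interpret Metric_space M d by (rule M)
  obtain C where C: "countable C" "C \<subseteq> M" "mtopology closure_of C = M"
    using assms(2) by (auto simp: separable_space_def X)
  \<comment> \<open>The balls of radius \<open>1/(n+1)\<close> around a countable dense set separate points.\<close>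
  define \<B> where "\<B> = (\<lambda>(c, n::nat). mball c (inverse (Suc n))) ` (C \<times> UNIV)"
  show thesis
  proof
    show "countable \<B>" unfolding \<B>_def using C(1) by auto
    show "openin X U" if "U \<in> \<B>" for U using that by (auto simp: \<B>_def X)
    fix x y assume x: "x \<in> topspace X" and y: "y \<in> topspace X"
      and eq: "\<And>U. U \<in> \<B> \<Longrightarrow> x \<in> U \<longleftrightarrow> y \<in> U"
    have xM: "x \<in> M" "y \<in> M" using x y by (auto simp: X)
    show "x = y"
    proof (rule ccontr)
      assume "x \<noteq> y"
      then have pos: "d x y / 2 > 0" using xM by simp
      then obtain n where n: "inverse (Suc n) < d x y / 2"
        using reals_Archimedean by blast
      have "x \<in> mtopology closure_of C" using C(3) xM by simp
      then obtain c where c: "c \<in> C" "c \<in> mball x (inverse (Suc n))"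
        unfolding metric_closure_of by (auto simp del: of_nat_Suc)
          (metis inverse_positive_iff_positive of_nat_0_less_iff zero_less_Suc)
      then have "x \<in> mball c (inverse (Suc n))" by (simp add: commute)
      moreover have "mball c (inverse (Suc n)) \<in> \<B>" using c(1) by (auto simp: \<B>_def)
      ultimately have "y \<in> mball c (inverse (Suc n))" using eq by blast
      then have "d c y < d x y / 2" "d x c < d x y / 2" "c \<in> M"
        using c(2) n by auto
      then show False using triangle[of x c y] xM by linarith
    qed
  qed
qed

text \<open>
  Second countability of \<open>bool\<close> is what identifies the product sigma-algebra on binary sequences with
  the Borel sets of the product topology.
\<close>

instance bool :: second_countable_topology
proof
  have "countable (UNIV :: bool set set)" by (rule countable_finite) simp
  moreover have "(open :: bool set \<Rightarrow> bool) = generate_topology UNIV"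
    by (auto simp: fun_eq_iff intro: generate_topology.Basis discrete_topology_class.open_discrete)
  ultimately show "\<exists>B::bool set set. countable B \<and> open = generate_topology B" by blast
qed

interpretation coin: sequence_space "measure_pmf (bernoulli_pmf (1/2))"
  by unfold_locales

abbreviation coin_flips :: "(nat \<Rightarrow> bool) measure" where
  "coin_flips \<equiv> \<Pi>\<^sub>M i\<in>UNIV. measure_pmf (bernoulli_pmf (1/2))"

lemma space_coin_flips: "space coin_flips = UNIV"
  by (simp add: space_PiM)

lemma sets_coin_flips: "sets coin_flips = sets borel"
proof -
  have "sets coin_flips = sets (\<Pi>\<^sub>M i\<in>(UNIV :: nat set). (borel :: bool measure))"
    by (intro sets_PiM_cong) (auto simp: sets_borel_eq_count_space)
  then show ?thesis by (simp add: sets_PiM_equal_borel)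
qed

lemma measurable_continuous_map_borel_of:
  fixes \<phi> :: "(nat \<Rightarrow> bool) \<Rightarrow> 'x"
  assumes "continuous_map euclidean X \<phi>"
  shows "\<phi> \<in> coin_flips \<rightarrow>\<^sub>M borel_of X"
  unfolding borel_of_def
proof (rule measurable_sigma_sets[OF sets_measure_of])
  show "{U. openin X U} \<subseteq> Pow (topspace X)"  "{U. openin X U} \<subseteq> Pow (topspace X)"
    by (auto dest: openin_subset)
  show "\<phi> \<in> space coin_flips \<rightarrow> topspace X"
    using assms by (auto simp: continuous_map_def)
  fix U assume "U \<in> {U. openin X U}"
  then have "open (\<phi> -` U)"
    using assms by (auto simp: continuous_map_def vimage_def)
  then show "\<phi> -` U \<inter> space coin_flips \<in> sets coin_flips"
    by (simp add: sets_coin_flips space_coin_flips)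
qed

text \<open>
  An event that ignores finitely many flips is a tail event: it is its own preimage under the map that
  resets the first \<open>n\<close> flips, and this map is measurable with respect to the remaining flips.
\<close>

lemma coin_flips_0_1_law:
  assumes X: "X \<in> sets coin_flips"
    and inv: "\<And>\<alpha> \<beta>. finite {n. \<alpha> n \<noteq> \<beta> n} \<Longrightarrow> \<alpha> \<in> X \<longleftrightarrow> \<beta> \<in> X"
  shows "coin.prob X = 0 \<or> coin.prob X = 1"
proof -
  let ?A = "\<lambda>i. {(\<lambda>\<omega>. \<omega> i) -` B \<inter> space coin_flips | B. B \<in> sets (measure_pmf (bernoulli_pmf (1/2)))}"
  let ?\<A> = "\<lambda>i. sigma_sets (space coin_flips) (?A i)"
  have "coin.indep_vars (\<lambda>_. measure_pmf (bernoulli_pmf (1/2))) (\<lambda>i \<omega>. \<omega> i) UNIV"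
  proof (subst coin.indep_vars_iff_distr_eq_PiM)
    show "distr coin_flips coin_flips (\<lambda>x. \<lambda>i\<in>UNIV. x i)
        = (\<Pi>\<^sub>M i\<in>UNIV. distr coin_flips (measure_pmf (bernoulli_pmf (1/2))) (\<lambda>\<omega>. \<omega> i))"
      by (simp add: restrict_def coin.PiM_component distr_id2)
  qed auto
  then have indep: "coin.indep_sets ?\<A> UNIV"
    by (simp add: coin.indep_vars_def)
  have "X \<in> sigma_sets (space coin_flips) (\<Union> (?\<A> ` {n..}))" for n
  proof -
    let ?S = "sigma (space coin_flips) (\<Union> (?\<A> ` {n..}))"
    let ?r = "\<lambda>\<omega> i. if i < n then False else \<omega> i"
    have sub: "\<Union> (?\<A> ` {n..}) \<subseteq> Pow (space coin_flips)"
      by (simp add: space_coin_flips)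
    have "?r \<in> ?S \<rightarrow>\<^sub>M coin_flips"
    proof (rule measurable_PiM_single')
      fix i
      show "(\<lambda>\<omega>. if i < n then False else \<omega> i) \<in> ?S \<rightarrow>\<^sub>M measure_pmf (bernoulli_pmf (1/2))"
      proof (cases "i < n")
        case False
        have "(\<lambda>\<omega>. \<omega> i) \<in> ?S \<rightarrow>\<^sub>M measure_pmf (bernoulli_pmf (1/2))"
        proof (rule measurableI)
          fix B :: "bool set"
          assume "B \<in> sets (measure_pmf (bernoulli_pmf (1/2)))"
          then have "(\<lambda>\<omega>. \<omega> i) -` B \<inter> space coin_flips \<in> ?\<A> i"
            by (intro sigma_sets.Basic) blast
          then have "(\<lambda>\<omega>. \<omega> i) -` B \<inter> space coin_flips \<in> \<Union> (?\<A> ` {n..})"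
            using False by (intro UN_I[of i]) auto
          then show "(\<lambda>\<omega>. \<omega> i) -` B \<inter> space ?S \<in> sets ?S"
            unfolding sets_measure_of[OF sub] space_measure_of[OF sub] by (rule sigma_sets.Basic)
        qed simp
        with False show ?thesis by simp
      qed simp
    qed (auto simp: space_coin_flips)
    from measurable_sets[OF this X] have "?r -` X \<in> sigma_sets (space coin_flips) (\<Union> (?\<A> ` {n..}))"
      unfolding sets_measure_of[OF sub] space_measure_of[OF sub] by (simp add: space_coin_flips)
    moreover have "?r -` X = X"
    proof -
      have "?r \<omega> \<in> X \<longleftrightarrow> \<omega> \<in> X" for \<omega>
      proof (rule inv)
        have "{i. ?r \<omega> i \<noteq> \<omega> i} \<subseteq> {..<n}"
          by (rule subsetI, rule ccontr) simp
        then show "finite {i. ?r \<omega> i \<noteq> \<omega> i}" using finite_subset by blast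
      qed
      then show ?thesis unfolding vimage_def by simp
    qed
    ultimately show ?thesis by simp
  qed
  then have "X \<in> coin.tail_events ?\<A>"
    by (simp add: coin.tail_events_def)
  then show ?thesis
    by (intro coin.kolmogorov_0_1_law[OF _ indep] sigma_algebra_sigma_sets)
      (auto simp: space_coin_flips)
qed

lemma null_sets_coin_flips_singleton: "{\<alpha>} \<in> null_sets coin_flips"
proof -
  have eq: "Pi UNIV (\<lambda>i. {\<alpha> i}) = {\<alpha>}" by (auto simp: Pi_def)
  have half: "measure (measure_pmf (bernoulli_pmf (1/2))) {b} = 1/2" for b
    by (cases b) (simp_all add: measure_pmf_single)
  have "(\<lambda>n. \<Prod>i\<le>n. 1/2 :: real) \<longlonglongrightarrow> coin.prob {\<alpha>}"
    using coin.measure_PiM_countable[of "\<lambda>i. {\<alpha> i}"] unfolding eq half by simp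
  moreover have "(\<lambda>n. \<Prod>i\<le>n. 1/2 :: real) \<longlonglongrightarrow> 0"
    by simp real_asymp
  ultimately have "coin.prob {\<alpha>} = 0" by (rule LIMSEQ_unique)
  moreover have "{\<alpha>} \<in> sets coin_flips" using coin.infprod_in_sets[of "\<lambda>i. {\<alpha> i}"] by (simp add: eq)
  ultimately show ?thesis by (simp add: null_sets_def coin.emeasure_eq_measure)
qed

lemma null_sets_coin_flips_tail_class: "{\<beta>. finite {n. \<alpha> n \<noteq> \<beta> n}} \<in> null_sets coin_flips"
proof -
  have "countable {N :: nat set. finite N}"
    using countable_Collect_finite by blast
  then have "countable ((\<lambda>N n. if n \<in> N then \<not> \<alpha> n else \<alpha> n) ` {N. finite N})"
    by (rule countable_image)
  moreover have "{\<beta>. finite {n. \<alpha> n \<noteq> \<beta> n}} \<subseteq> (\<lambda>N n. if n \<in> N then \<not> \<alpha> n else \<alpha> n) ` {N. finite N}"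
  proof
    fix \<beta> assume "\<beta> \<in> {\<beta>. finite {n. \<alpha> n \<noteq> \<beta> n}}"
    then show "\<beta> \<in> (\<lambda>N n. if n \<in> N then \<not> \<alpha> n else \<alpha> n) ` {N. finite N}"
      by (intro image_eqI[of _ _ "{n. \<alpha> n \<noteq> \<beta> n}"]) auto
  qed
  ultimately have "countable {\<beta>. finite {n. \<alpha> n \<noteq> \<beta> n}}"
    by (rule countable_subset[rotated])
  then have "(\<Union>\<beta>\<in>{\<beta>. finite {n. \<alpha> n \<noteq> \<beta> n}}. {\<beta>}) \<in> null_sets coin_flips"
    by (intro null_sets_UN') (auto intro: null_sets_coin_flips_singleton)
  then show ?thesis by simp
qed

lemma not_smooth_if_reduces_E0:
  fixes X :: "'x topology"
  assumes cont: "continuous_map euclidean X \<phi>"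
    and reduces: "\<And>\<alpha> \<beta> :: nat \<Rightarrow> bool. (\<phi> \<alpha>, \<phi> \<beta>) \<in> E \<longleftrightarrow> finite {n. \<alpha> n \<noteq> \<beta> n}"
  shows "\<not> smooth TYPE('y) X E"
proof
  assume "smooth TYPE('y) X E"
  then obtain Y :: "'y measure" and \<theta> where Y: "standard_borel Y"
    and \<theta>: "\<theta> \<in> borel_of X \<rightarrow>\<^sub>M Y"
    and E: "\<And>x y. x \<in> topspace X \<Longrightarrow> y \<in> topspace X \<Longrightarrow> (x, y) \<in> E \<longleftrightarrow> \<theta> x = \<theta> y"
    unfolding smooth_def by blast
  obtain T where T: "metrizable_space T" "separable_space T" "sets Y = sets (borel_of T)"
    using Y completely_metrizable_imp_metrizable_space by (auto simp: standard_borel_def)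
  have sets_Y: "sets Y = sigma_sets (topspace T) {U. openin T U}"
    unfolding T(3) borel_of_def by (rule sets_measure_of) (auto dest: openin_subset)
  have "space Y = topspace T"
    using sets_eq_imp_space_eq[OF T(3)] by (simp add: borel_of_def space_measure_of_conv)
  obtain \<B> where \<B>: "countable \<B>" "\<And>U. U \<in> \<B> \<Longrightarrow> openin T U"
    and sep: "\<And>x y. x \<in> topspace T \<Longrightarrow> y \<in> topspace T \<Longrightarrow> (\<And>U. U \<in> \<B> \<Longrightarrow> x \<in> U \<longleftrightarrow> y \<in> U) \<Longrightarrow> x = y"
    using countable_separating_open_sets[OF T(1,2)] by metis
  have top: "\<phi> \<alpha> \<in> topspace X" for \<alpha>
    using cont by (auto simp: continuous_map_def)
  define \<psi> where "\<psi> = \<theta> \<circ> \<phi>"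
  have \<psi>: "\<psi> \<in> coin_flips \<rightarrow>\<^sub>M Y"
    unfolding \<psi>_def by (rule measurable_comp[OF measurable_continuous_map_borel_of[OF cont] \<theta>])
  have \<psi>_eq: "\<psi> \<alpha> = \<psi> \<beta> \<longleftrightarrow> finite {n. \<alpha> n \<noteq> \<beta> n}" for \<alpha> \<beta>
    unfolding \<psi>_def using E[OF top top] reduces by simp
  have \<psi>_space: "\<psi> \<alpha> \<in> topspace T" for \<alpha>
    using measurable_space[OF \<psi>] by (simp add: space_coin_flips \<open>space Y = topspace T\<close>)
  have meas: "\<psi> -` U \<in> sets coin_flips" if "U \<in> \<B>" for U
  proof -
    have "U \<in> sets Y" using \<B>(2)[OF that] by (auto simp: sets_Y)
    from measurable_sets[OF \<psi> this] show ?thesis by (simp add: space_coin_flips)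
  qed
  have "\<forall>U\<in>\<B>. \<exists>b. AE \<alpha> in coin_flips. \<psi> \<alpha> \<in> U \<longleftrightarrow> b"
  proof
    fix U assume U: "U \<in> \<B>"
    have "coin.prob (\<psi> -` U) = 0 \<or> coin.prob (\<psi> -` U) = 1"
      by (rule coin_flips_0_1_law[OF meas[OF U]]) (metis \<psi>_eq vimage_eq)
    then show "\<exists>b. AE \<alpha> in coin_flips. \<psi> \<alpha> \<in> U \<longleftrightarrow> b"
    proof
      assume "coin.prob (\<psi> -` U) = 0"
      then have "AE \<alpha> in coin_flips. \<alpha> \<notin> \<psi> -` U"
        using coin.prob_eq_0[OF meas[OF U]] by blast
      then show ?thesis by (intro exI[of _ False]) simp
    next
      assume "coin.prob (\<psi> -` U) = 1"
      then have "AE \<alpha> in coin_flips. \<alpha> \<in> \<psi> -` U"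
        using coin.prob_eq_1[OF meas[OF U]] by blast
      then show ?thesis by (intro exI[of _ True]) simp
    qed
  qed
  then obtain b where "\<And>U. U \<in> \<B> \<Longrightarrow> AE \<alpha> in coin_flips. \<psi> \<alpha> \<in> U \<longleftrightarrow> b U"
    by metis
  then have ae: "AE \<alpha> in coin_flips. \<forall>U\<in>\<B>. \<psi> \<alpha> \<in> U \<longleftrightarrow> b U"
    using \<B>(1) by (simp add: AE_ball_countable)
  obtain \<alpha> where \<alpha>: "\<And>U. U \<in> \<B> \<Longrightarrow> \<psi> \<alpha> \<in> U \<longleftrightarrow> b U"
    using eventually_happens[OF ae] by (auto simp: trivial_limit_def)
  have "AE \<beta> in coin_flips. finite {n. \<alpha> n \<noteq> \<beta> n}"
    using ae
  proof eventually_elim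
    case (elim \<beta>)
    then have "\<psi> \<alpha> = \<psi> \<beta>" using \<alpha> by (intro sep \<psi>_space) simp
    then show ?case by (simp add: \<psi>_eq)
  qed
  moreover have "AE \<beta> in coin_flips. \<not> finite {n. \<alpha> n \<noteq> \<beta> n}"
    using AE_not_in[OF null_sets_coin_flips_tail_class[of \<alpha>]] by simp
  ultimately have "AE \<beta> in coin_flips. False"
    by eventually_elim simp
  then show False by simp
qed

section \<open>Dyadic rationals\<close>

text \<open>
  The ring of all dyadic rationals, negative ones included: unlike \<open>dyadics\<close> it is closed under
  subtraction.
\<close>

definition dyadic_ring :: "real set" where
  "dyadic_ring = {x. \<exists>k::nat. x * 2 ^ k \<in> \<int>}"

lemma dyadic_ring_add:
  assumes "x \<in> dyadic_ring" "y \<in> dyadic_ring"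
  shows "x + y \<in> dyadic_ring"
proof -
  obtain k l :: nat where k: "x * 2 ^ k \<in> \<int>" and l: "y * 2 ^ l \<in> \<int>"
    using assms by (auto simp: dyadic_ring_def)
  have "(x + y) * 2 ^ (k + l) = (x * 2 ^ k) * 2 ^ l + (y * 2 ^ l) * 2 ^ k"
    by (simp add: algebra_simps power_add)
  also have "\<dots> \<in> \<int>"
    by (intro Ints_add Ints_mult[OF k] Ints_mult[OF l] Ints_power Ints_numeral)
  finally show ?thesis by (auto simp: dyadic_ring_def)
qed

lemma dyadic_ring_uminus: "x \<in> dyadic_ring \<Longrightarrow> - x \<in> dyadic_ring"
  by (auto simp: dyadic_ring_def)

lemma dyadic_ring_diff: "x \<in> dyadic_ring \<Longrightarrow> y \<in> dyadic_ring \<Longrightarrow> x - y \<in> dyadic_ring"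
  using dyadic_ring_add[OF _ dyadic_ring_uminus, of x y] by simp

lemma dyadic_ring_powi_mult:
  assumes "x \<in> dyadic_ring"
  shows "2 powi m * x \<in> dyadic_ring"
proof -
  obtain k :: nat where k: "x * 2 ^ k \<in> \<int>"
    using assms by (auto simp: dyadic_ring_def)
  show ?thesis
  proof (cases "m \<ge> 0")
    case True
    then have "2 powi m * x * 2 ^ k = 2 ^ nat m * (x * 2 ^ k)"
      by (simp add: power_int_def)
    also have "\<dots> \<in> \<int>" by (intro Ints_mult[OF _ k] Ints_power Ints_numeral)
    finally show ?thesis by (auto simp: dyadic_ring_def)
  next
    case False
    then have "2 powi m * x * 2 ^ (k + nat (- m)) = x * 2 ^ k"
      by (simp add: power_int_def power_add field_simps)
    then show ?thesis using k unfolding dyadic_ring_def by (metis (mono_tags) mem_Collect_eq)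
  qed
qed

lemma dyadics_iff_dyadic_ring:
  assumes "0 \<le> x"
  shows "x \<in> dyadics \<longleftrightarrow> x \<in> dyadic_ring"
proof
  assume "x \<in> dyadics"
  then obtain k m where "x = of_nat m / 2 ^ k" by (auto simp: dyadics_def)
  then have "x * 2 ^ k \<in> \<int>" by simp
  then show "x \<in> dyadic_ring" by (auto simp: dyadic_ring_def)
next
  assume "x \<in> dyadic_ring"
  then obtain k where "x * 2 ^ k \<in> \<int>" by (auto simp: dyadic_ring_def)
  then obtain z where z: "x * 2 ^ k = of_int z" by (elim Ints_cases)
  then have "0 \<le> z" using assms by (metis mult_nonneg_nonneg of_int_0_le_iff zero_le_numeral zero_le_power)
  then have "x = of_nat (nat z) / 2 ^ k" using z by (simp add: field_simps)
  then show "x \<in> dyadics" by (auto simp: dyadics_def)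
qed

lemma dyadics_affine_iff:
  fixes a b t y :: real
  assumes "a \<in> dyadics" "b \<in> dyadics" "0 \<le> t" "0 \<le> y" and y: "y = b + 2 powi k * (t - a)"
  shows "y \<in> dyadics \<longleftrightarrow> t \<in> dyadics"
proof -
  have [simp]: "0 \<le> d" if "d \<in> dyadics" for d :: real
    using that by (auto simp: dyadics_def)
  have ab: "a \<in> dyadic_ring" "b \<in> dyadic_ring"
    using assms by (auto simp flip: dyadics_iff_dyadic_ring)
  have t: "t = a + 2 powi (- k) * (y - b)"
    by (simp add: y power_int_minus field_simps)
  have "y \<in> dyadic_ring" if "t \<in> dyadic_ring"
    unfolding y by (intro dyadic_ring_add dyadic_ring_powi_mult dyadic_ring_diff ab that)
  moreover have "t \<in> dyadic_ring" if "y \<in> dyadic_ring"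
    by (subst t) (intro dyadic_ring_add dyadic_ring_powi_mult dyadic_ring_diff ab that)
  ultimately show ?thesis
    using assms by (auto simp: dyadics_iff_dyadic_ring)
qed

lemma dyadics_dense:
  fixes p q :: real
  assumes "0 \<le> p" "p < q"
  obtains d where "d \<in> dyadics" "p < d" "d < q"
proof -
  obtain n where n: "1 / (q - p) < 2 ^ n"
    using real_arch_pow[of 2 "1 / (q - p)"] by auto
  define m where "m = nat (\<lfloor>p * 2 ^ n\<rfloor> + 1)"
  have "0 \<le> p * 2 ^ n" using assms by simp
  then have m: "real m = of_int \<lfloor>p * 2 ^ n\<rfloor> + 1" unfolding m_def by simp
  have "p * 2 ^ n < real m" "real m \<le> p * 2 ^ n + 1" unfolding m by linarith+
  moreover have "p * 2 ^ n + 1 < q * 2 ^ n" using n assms by (simp add: field_simps)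
  ultimately have "p < real m / 2 ^ n" "real m / 2 ^ n < q"
    by (simp_all add: field_simps)
  then show thesis using that by (auto simp: dyadics_def)
qed

section \<open>Maps in Thompson's group\<close>

lemma thompson_mapsI:
  assumes "f \<in> extensional {0..1}" "f ` {0..1} = {0..1}" "continuous_on {0..1} f"
    "strict_mono_on {0..1} f" "dyadic_piecewise_linear f"
  shows "f \<in> thompson_maps"
proof -
  have inj: "inj_on f {0..1}" using assms(4) by (rule strict_mono_on_imp_inj_on)
  then have "f \<in> Bij {0..1}" using assms by (simp add: Bij_def bij_betw_def)
  moreover have "\<exists>h. homeomorphism {0..1} {0..1} f h"
    using assms inj by (intro homeomorphism_compact) auto
  ultimately show ?thesis using assms by (simp add: thompson_maps_def)
qed

lemma thompson_mapsD:
  assumes "f \<in> thompson_maps"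
  shows "f \<in> extensional {0..1}" "f ` {0..1} = {0..1}" "continuous_on {0..1} f"
    "strict_mono_on {0..1} f" "dyadic_piecewise_linear f" "f \<in> Bij {0..1}"
  using assms by (auto simp: thompson_maps_def Bij_def bij_betw_def homeomorphism_def)

lemma thompson_maps_mem:
  assumes "f \<in> thompson_maps" "0 \<le> x" "x \<le> 1"
  shows "0 \<le> f x" "f x \<le> 1"
  using thompson_mapsD(2)[OF assms(1)] assms(2,3) by auto

lemma thompson_maps_less_iff:
  assumes "f \<in> thompson_maps" "x \<in> {0..1}" "y \<in> {0..1}"
  shows "f x < f y \<longleftrightarrow> x < y"
  using strict_mono_on_less[OF thompson_mapsD(4)[OF assms(1)] assms(2,3)] .

lemma thompson_maps_eq_iff:
  assumes "f \<in> thompson_maps" "x \<in> {0..1}" "y \<in> {0..1}"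
  shows "f x = f y \<longleftrightarrow> x = y"
  using strict_mono_on_eq[OF thompson_mapsD(4)[OF assms(1)] assms(2,3)] .

lemma thompson_maps_le_iff:
  assumes "f \<in> thompson_maps" "x \<in> {0..1}" "y \<in> {0..1}"
  shows "f x \<le> f y \<longleftrightarrow> x \<le> y"
  using strict_mono_on_less_eq[OF thompson_mapsD(4)[OF assms(1)] assms(2,3)] .

lemma thompson_maps_surj:
  assumes "f \<in> thompson_maps" "y \<in> {0..1}"
  obtains x where "x \<in> {0..1}" "f x = y"
  using thompson_mapsD(2)[OF assms(1)] assms(2) by (metis imageE)

lemma thompson_maps_0:
  assumes f: "f \<in> thompson_maps"
  shows "f 0 = 0"
proof -
  obtain x where x: "x \<in> {0..1}" "f x = 0"
    by (rule thompson_maps_surj[OF f, of 0]) auto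
  then have "f 0 \<le> 0" using thompson_maps_le_iff[OF f, of 0 x] by simp
  then show ?thesis using thompson_maps_mem[OF f, of 0] by simp
qed

lemma thompson_maps_breakpoints:
  assumes "f \<in> thompson_maps"
  obtains B where "finite B" "B \<subseteq> dyadics"
    "\<And>x y. 0 \<le> x \<Longrightarrow> x < y \<Longrightarrow> y \<le> 1 \<Longrightarrow> {x<..<y} \<inter> B = {} \<Longrightarrow>
       \<exists>(k::int) c. \<forall>t\<in>{x..y}. f t = 2 powi k * t + c"
proof -
  obtain B where "finite B \<and> B \<subseteq> dyadics \<and>
      (\<forall>x y. 0 \<le> x \<and> x < y \<and> y \<le> 1 \<and> {x<..<y} \<inter> B = {} \<longrightarrow>
         (\<exists>(k::int) c. \<forall>t\<in>{x..y}. f t = 2 powi k * t + c))"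
    using thompson_mapsD(5)[OF assms] unfolding dyadic_piecewise_linear_def by (elim exE)
  then show thesis by (intro that[of B]) simp_all
qed

text \<open>
  Induction over the breakpoints to the left of \<open>x\<close>: on the piece that ends at \<open>x\<close>, the map is affine
  with slope a power of \<open>2\<close>, and it sends the dyadic left end of that piece to a dyadic number. The
  statement is what makes the breakpoints of composites and inverses dyadic.
\<close>

lemma thompson_maps_dyadics_iff:
  assumes f: "f \<in> thompson_maps" and x: "0 \<le> x" "x \<le> 1"
  shows "f x \<in> dyadics \<longleftrightarrow> x \<in> dyadics"
proof -
  obtain B where B: "finite B" "B \<subseteq> dyadics"
    and affine: "\<And>x y. 0 \<le> x \<Longrightarrow> x < y \<Longrightarrow> y \<le> 1 \<Longrightarrow> {x<..<y} \<inter> B = {} \<Longrightarrow>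
       \<exists>(k::int) c. \<forall>t\<in>{x..y}. f t = 2 powi k * t + c"
    using thompson_maps_breakpoints[OF f] by metis
  show ?thesis using x
  proof (induction "card (B \<inter> {0..<x})" arbitrary: x rule: less_induct)
    case (less x)
    show ?case
    proof (cases "x = 0")
      case True
      then show ?thesis by (simp add: thompson_maps_0[OF f])
    next
      case False
      define A where "A = insert 0 (B \<inter> {0..<x})"
      \<comment> \<open>The last breakpoint before \<open>x\<close>, or \<open>0\<close>\<close>
      define b where "b = Max A"
      have A: "finite A" "A \<noteq> {}" using B by (auto simp: A_def)
      have "b \<in> A" unfolding b_def by (rule Max_in[OF A])
      then have b: "0 \<le> b" "b < x" "b \<le> 1" using False less.prems by (auto simp: A_def)
      have "b \<in> dyadics"
        using \<open>b \<in> A\<close> B(2) real_in_dyadics[of 0] by (auto simp: A_def)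
      have "f b \<in> dyadics"
      proof (cases "b = 0")
        case True
        then show ?thesis using \<open>b \<in> dyadics\<close> by (simp add: thompson_maps_0[OF f])
      next
        case False
        then have "b \<in> B" using \<open>b \<in> A\<close> by (auto simp: A_def)
        then have "B \<inter> {0..<b} \<subset> B \<inter> {0..<x}" using b by auto
        then have "card (B \<inter> {0..<b}) < card (B \<inter> {0..<x})"
          using B by (intro psubset_card_mono) auto
        then show ?thesis using less.hyps b \<open>b \<in> dyadics\<close> by simp
      qed
      have "{b<..<x} \<inter> B = {}"
      proof (rule ccontr)
        assume "{b<..<x} \<inter> B \<noteq> {}"
        then obtain z where "z \<in> B" "b < z" "z < x" by auto
        then have "z \<in> A" using b by (auto simp: A_def)
        then have "z \<le> b" unfolding b_def using A by simp
        then show False using \<open>b < z\<close> by simp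
      qed
      then obtain k c where kc: "\<forall>t\<in>{b..x}. f t = 2 powi k * t + c"
        using affine b less.prems by blast
      then have "f x = f b + 2 powi k * (x - b)" using b by (simp add: algebra_simps)
      then show ?thesis
        using dyadics_affine_iff[OF \<open>b \<in> dyadics\<close> \<open>f b \<in> dyadics\<close>]
          less.prems thompson_maps_mem[OF f] by blast
    qed
  qed
qed

lemma thompson_maps_compose:
  assumes f: "f \<in> thompson_maps" and g: "g \<in> thompson_maps"
  shows "compose {0..1} f g \<in> thompson_maps"
proof (rule thompson_mapsI)
  have eq: "compose {0..1} f g x = f (g x)" if "x \<in> {0..1}" for x
    using that by (simp add: compose_eq)
  show "compose {0..1} f g \<in> extensional {0..1}" by simp
  show "compose {0..1} f g ` {0..1} = {0..1}"
  proof -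
    have "compose {0..1} f g ` {0..1} = f ` (g ` {0..1})" by (auto simp: eq)
    then show ?thesis using thompson_mapsD(2)[OF f] thompson_mapsD(2)[OF g] by simp
  qed
  have "continuous_on {0..1} (f \<circ> g)"
    using thompson_mapsD(2,3)[OF f] thompson_mapsD(2,3)[OF g] by (intro continuous_on_compose) auto
  then show "continuous_on {0..1} (compose {0..1} f g)"
    by (rule continuous_on_eq) (simp add: eq)
  show "strict_mono_on {0..1} (compose {0..1} f g)"
  proof (rule strict_mono_onI)
    fix x y :: real assume "x \<in> {0..1}" "y \<in> {0..1}" "x < y"
    then show "compose {0..1} f g x < compose {0..1} f g y"
      using thompson_maps_mem[OF g] by (simp add: eq thompson_maps_less_iff[OF f] thompson_maps_less_iff[OF g])
  qed
  obtain B where B: "finite B" "B \<subseteq> dyadics"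
    and affine: "\<And>x y. 0 \<le> x \<Longrightarrow> x < y \<Longrightarrow> y \<le> 1 \<Longrightarrow> {x<..<y} \<inter> B = {} \<Longrightarrow>
       \<exists>(k::int) c. \<forall>t\<in>{x..y}. f t = 2 powi k * t + c"
    using thompson_maps_breakpoints[OF f] by metis
  obtain C where C: "finite C" "C \<subseteq> dyadics"
    and affine': "\<And>x y. 0 \<le> x \<Longrightarrow> x < y \<Longrightarrow> y \<le> 1 \<Longrightarrow> {x<..<y} \<inter> C = {} \<Longrightarrow>
       \<exists>(k::int) c. \<forall>t\<in>{x..y}. g t = 2 powi k * t + c"
    using thompson_maps_breakpoints[OF g] by metis
  \<comment> \<open>The composite can break where \<open>g\<close> breaks and where \<open>g\<close> hits a breakpoint of \<open>f\<close>.\<close>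
  define B' where "B' = {x \<in> {0..1}. g x \<in> B}"
  show "dyadic_piecewise_linear (compose {0..1} f g)"
    unfolding dyadic_piecewise_linear_def
  proof (intro exI[of _ "C \<union> B'"] conjI allI impI)
    have "inj_on g {0..1}" using thompson_mapsD(4)[OF g] by (rule strict_mono_on_imp_inj_on)
    then have "finite (g -` B \<inter> {0..1})" using B(1) by (intro finite_vimage_IntI)
    moreover have "B' = g -` B \<inter> {0..1}" by (auto simp: B'_def)
    ultimately show "finite (C \<union> B')" using C by simp
    show "C \<union> B' \<subseteq> dyadics"
      using B(2) C(2) thompson_maps_dyadics_iff[OF g] by (auto simp: B'_def)
    fix x y :: real
    assume xy: "0 \<le> x \<and> x < y \<and> y \<le> 1 \<and> {x<..<y} \<inter> (C \<union> B') = {}"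
    have mem: "x \<in> {0..1}" "y \<in> {0..1}" using xy by auto
    have "{x<..<y} \<inter> C = {}" using xy by blast
    then obtain k c where kc: "\<forall>t\<in>{x..y}. g t = 2 powi k * t + c"
      using affine' xy by blast
    have "{g x<..<g y} \<inter> B = {}"
    proof (rule ccontr)
      assume "{g x<..<g y} \<inter> B \<noteq> {}"
      then obtain z where z: "z \<in> B" "g x < z" "z < g y" by auto
      then have "z \<in> {0..1}" using thompson_maps_mem[OF g, of x] thompson_maps_mem[OF g, of y] xy by auto
      then obtain w where w: "w \<in> {0..1}" "g w = z" using thompson_maps_surj[OF g] by blast
      then have "w \<in> {x<..<y} \<inter> B'"
        using z mem thompson_maps_less_iff[OF g] by (auto simp: B'_def)
      then show False using xy by blast
    qed
    moreover have "g x < g y" using mem xy thompson_maps_less_iff[OF g] by blast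
    moreover have "0 \<le> g x" "g y \<le> 1" using thompson_maps_mem[OF g] xy by auto
    ultimately obtain l d where ld: "\<forall>t\<in>{g x..g y}. f t = 2 powi l * t + d"
      using affine by blast
    have "\<forall>t\<in>{x..y}. compose {0..1} f g t = 2 powi (l + k) * t + (2 powi l * c + d)"
    proof
      fix t assume t: "t \<in> {x..y}"
      then have "t \<in> {0..1}" using xy by auto
      then have "g t \<in> {g x..g y}" using t mem thompson_maps_le_iff[OF g] by auto
      then show "compose {0..1} f g t = 2 powi (l + k) * t + (2 powi l * c + d)"
        using \<open>t \<in> {0..1}\<close> t ld kc by (simp add: eq power_int_add algebra_simps)
    qed
    then show "\<exists>(k::int) c. \<forall>t\<in>{x..y}. compose {0..1} f g t = 2 powi k * t + c" by blast
  qed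
qed

lemma thompson_maps_inverse:
  assumes f: "f \<in> thompson_maps"
  shows "restrict (inv_into {0..1} f) {0..1} \<in> thompson_maps" (is "?g \<in> _")
proof (rule thompson_mapsI)
  have fg: "f (?g y) = y" if "y \<in> {0..1}" for y
    using that thompson_mapsD(2)[OF f] by (simp add: f_inv_into_f)
  have gf: "?g (f x) = x" if "x \<in> {0..1}" for x
    using that thompson_maps_mem[OF f] strict_mono_on_imp_inj_on[OF thompson_mapsD(4)[OF f]]
    by (simp add: inv_into_f_f)
  have g_mem: "?g y \<in> {0..1}" if "y \<in> {0..1}" for y
    using that thompson_mapsD(2)[OF f] by (metis inv_into_into restrict_apply')
  show "?g \<in> extensional {0..1}" by simp
  show "?g ` {0..1} = {0..1}"
  proof
    show "?g ` {0..1} \<subseteq> {0..1}" using g_mem by blast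
    show "{0..1} \<subseteq> ?g ` {0..1}"
      using gf thompson_mapsD(2)[OF f] by (metis imageI subsetI)
  qed
  obtain h where h: "homeomorphism {0..1} {0..1} f h"
    using f by (auto simp: thompson_maps_def)
  have "h y = ?g y" if "y \<in> {0..1}" for y
    using h that fg g_mem by (metis homeomorphism_apply1)
  then show "continuous_on {0..1} ?g"
    using homeomorphism_cont2[OF h] continuous_on_eq by blast
  show "strict_mono_on {0..1} ?g"
  proof (rule strict_mono_onI)
    fix x y :: real assume "x \<in> {0..1}" "y \<in> {0..1}" "x < y"
    then show "?g x < ?g y"
      using thompson_maps_less_iff[OF f g_mem g_mem] fg by metis
  qed
  obtain B where B: "finite B" "B \<subseteq> dyadics"
    and affine: "\<And>x y. 0 \<le> x \<Longrightarrow> x < y \<Longrightarrow> y \<le> 1 \<Longrightarrow> {x<..<y} \<inter> B = {} \<Longrightarrow>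
       \<exists>(k::int) c. \<forall>t\<in>{x..y}. f t = 2 powi k * t + c"
    using thompson_maps_breakpoints[OF f] by metis
  show "dyadic_piecewise_linear ?g"
    unfolding dyadic_piecewise_linear_def
  proof (intro exI[of _ "f ` (B \<inter> {0..1})"] conjI allI impI)
    show "finite (f ` (B \<inter> {0..1}))" using B by simp
    show "f ` (B \<inter> {0..1}) \<subseteq> dyadics"
      using B thompson_maps_dyadics_iff[OF f] by auto
    fix x y :: real
    assume xy: "0 \<le> x \<and> x < y \<and> y \<le> 1 \<and> {x<..<y} \<inter> f ` (B \<inter> {0..1}) = {}"
    define u v where "u = ?g x" and "v = ?g y"
    have uv: "u \<in> {0..1}" "v \<in> {0..1}" "f u = x" "f v = y"
      using xy g_mem fg by (auto simp: u_def v_def simp del: restrict_apply)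
    have "u < v" using uv xy thompson_maps_less_iff[OF f] by metis
    moreover have "{u<..<v} \<inter> B = {}"
    proof (rule ccontr)
      assume "{u<..<v} \<inter> B \<noteq> {}"
      then obtain z where z: "z \<in> B" "u < z" "z < v" by auto
      then have "z \<in> {0..1}" using uv by auto
      then have "x < f z" "f z < y"
        using z uv thompson_maps_less_iff[OF f] by metis+
      then show False using xy z \<open>z \<in> {0..1}\<close> by auto
    qed
    ultimately obtain k c where kc: "\<forall>t\<in>{u..v}. f t = 2 powi k * t + c"
      using affine uv by (metis atLeastAtMost_iff)
    have "\<forall>t\<in>{x..y}. ?g t = 2 powi (- k) * t + (- (2 powi (- k) * c))"
    proof
      fix t assume t: "t \<in> {x..y}"
      then have t01: "t \<in> {0..1}" using xy by auto
      have "f u \<le> f (?g t)" "f (?g t) \<le> f v" using t uv(3,4) fg[OF t01] by auto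
      then have "?g t \<in> {u..v}"
        using uv(1,2) g_mem[OF t01] thompson_maps_le_iff[OF f] by auto
      then have "t = 2 powi k * ?g t + c" using kc fg[OF t01] by metis
      then have "?g t = (t - c) / 2 powi k" by (simp add: field_simps del: restrict_apply)
      then show "?g t = 2 powi (- k) * t + (- (2 powi (- k) * c))"
        by (simp add: power_int_minus field_simps del: restrict_apply)
    qed
    then show "\<exists>(k::int) c. \<forall>t\<in>{x..y}. ?g t = 2 powi k * t + c" by blast
  qed
qed

lemma subgroup_thompson_maps: "subgroup thompson_maps (BijGroup {0..1})"
proof (rule group.subgroupI[OF group_BijGroup])
  show "thompson_maps \<subseteq> carrier (BijGroup {0..1})"
    using thompson_mapsD(6) by (auto simp: BijGroup_def)
  have "restrict (\<lambda>x. x) {0..1} \<in> thompson_maps"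
  proof (rule thompson_mapsI)
    show "dyadic_piecewise_linear (restrict (\<lambda>x. x) {0..1})"
      unfolding dyadic_piecewise_linear_def
      by (intro exI[of _ "{}"] conjI allI impI exI[of _ 0] ballI) auto
  qed (auto simp: strict_mono_on_def intro: continuous_on_eq[OF continuous_on_id])
  then show "thompson_maps \<noteq> {}" by auto
  fix f assume f: "f \<in> thompson_maps"
  show "inv\<^bsub>BijGroup {0..1}\<^esub> f \<in> thompson_maps"
    using thompson_maps_inverse[OF f] inv_BijGroup[OF thompson_mapsD(6)[OF f]] by (simp add: restrict_def)
  fix g assume g: "g \<in> thompson_maps"
  show "f \<otimes>\<^bsub>BijGroup {0..1}\<^esub> g \<in> thompson_maps"
    using thompson_maps_compose[OF f g] thompson_mapsD(6)[OF f] thompson_mapsD(6)[OF g]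
    by (simp add: BijGroup_def)
qed

interpretation F: group thompson_F
  unfolding thompson_F_def by (rule group.subgroup_imp_group[OF group_BijGroup subgroup_thompson_maps])

lemma carrier_thompson_F [simp]: "carrier thompson_F = thompson_maps"
  by (simp add: thompson_F_def)

lemma thompson_mult_apply:
  assumes "f \<in> thompson_maps" "g \<in> thompson_maps" "x \<in> {0..1}"
  shows "(f \<otimes>\<^bsub>thompson_F\<^esub> g) x = f (g x)"
  using assms(3) thompson_mapsD(6)[OF assms(1)] thompson_mapsD(6)[OF assms(2)]
  by (simp add: thompson_F_def BijGroup_def compose_eq)

lemma thompson_one_apply: "x \<in> {0..1} \<Longrightarrow> \<one>\<^bsub>thompson_F\<^esub> x = x"
  by (simp add: thompson_F_def BijGroup_def)

lemma thompson_inv_mem: "f \<in> thompson_maps \<Longrightarrow> inv\<^bsub>thompson_F\<^esub> f \<in> thompson_maps"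
  using F.inv_closed by simp

lemma thompson_inv_apply:
  assumes "f \<in> thompson_maps" "x \<in> {0..1}"
  shows "(inv\<^bsub>thompson_F\<^esub> f) (f x) = x" "f ((inv\<^bsub>thompson_F\<^esub> f) x) = x"
  using thompson_mult_apply[OF thompson_inv_mem[OF assms(1)] assms(1) assms(2)]
    thompson_mult_apply[OF assms(1) thompson_inv_mem[OF assms(1)] assms(2)]
    assms thompson_one_apply by auto

lemma thompson_maps_eqI:
  assumes "f \<in> thompson_maps" "g \<in> thompson_maps" "\<And>x. x \<in> {0..1} \<Longrightarrow> f x = g x"
  shows "f = g"
  using extensionalityI[OF thompson_mapsD(1)[OF assms(1)] thompson_mapsD(1)[OF assms(2)]] assms(3) by blast

text \<open>
  The local form of the elements of \<open>F\<close> at a fixed point. At the end of the initial interval of fixed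
  points it decides the sign of an element; at \<open>0\<close> it says that the germ is a power of \<open>2\<close>.
\<close>

lemma thompson_maps_affine_right_of_fixed_point:
  assumes f: "f \<in> thompson_maps" and t: "0 \<le> t" "t < 1" "f t = t"
  obtains u k where "t < u" "u \<le> 1" "\<And>x. x \<in> {t..u} \<Longrightarrow> f x = t + 2 powi k * (x - t)"
proof -
  obtain B where B: "finite B"
    and affine: "\<And>x y. 0 \<le> x \<Longrightarrow> x < y \<Longrightarrow> y \<le> 1 \<Longrightarrow> {x<..<y} \<inter> B = {} \<Longrightarrow>
       \<exists>(k::int) c. \<forall>t\<in>{x..y}. f t = 2 powi k * t + c"
    using thompson_maps_breakpoints[OF f] by metis
  define A where "A = insert 1 (B \<inter> {t<..1})"
  define u where "u = Min A"
  have A: "finite A" "A \<noteq> {}" using B by (auto simp: A_def)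
  have "u \<in> A" unfolding u_def by (rule Min_in[OF A])
  then have u: "t < u" "u \<le> 1" using t by (auto simp: A_def)
  have "{t<..<u} \<inter> B = {}"
  proof (rule ccontr)
    assume "{t<..<u} \<inter> B \<noteq> {}"
    then obtain z where z: "z \<in> B" "t < z" "z < u" by auto
    then have "z \<in> A" using u by (auto simp: A_def)
    then have "u \<le> z" unfolding u_def using A by simp
    then show False using z by simp
  qed
  then obtain k c where kc: "\<forall>x\<in>{t..u}. f x = 2 powi k * x + c"
    using affine u t by blast
  show thesis
  proof
    show "t < u" "u \<le> 1" by (fact u)+
    have c: "t = 2 powi k * t + c" using kc u t by (metis atLeastAtMost_iff less_eq_real_def)
    fix x assume "x \<in> {t..u}"
    then have "f x = 2 powi k * x + c" using kc by blast
    then show "f x = t + 2 powi k * (x - t)" using c by (simp add: algebra_simps)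
  qed
qed

section \<open>Elements supported in a dyadic interval\<close>

text \<open>
  The standard generator of \<open>F\<close>, with slopes \<open>2\<close>, \<open>1\<close> and \<open>1/2\<close>, rescaled to \<open>[a,b]\<close> and extended by the
  identity. On \<open>[a,b]\<close> it is concave, hence the minimum of its three affine pieces; outside \<open>[a,b]\<close> this
  minimum lies below the diagonal, which the maximum with \<open>x\<close> corrects. In this form continuity
  and monotonicity are immediate.
\<close>

definition bump :: "real \<Rightarrow> real \<Rightarrow> real \<Rightarrow> real" where
  "bump a b = (\<lambda>x\<in>{0..1}. max x (min (2 * x - a) (min (x + (b - a) / 4) ((x + b) / 2))))"

lemma bump_eq_self:
  assumes "a < b" "x \<in> {0..1}" "x \<le> a \<or> b \<le> x"
  shows "bump a b x = x"
  using assms by (auto simp: bump_def max_def min_def field_simps)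

lemma bump_greater:
  assumes "a < x" "x < b" "x \<in> {0..1}"
  shows "x < bump a b x"
  using assms by (simp add: bump_def less_max_iff_disj)

lemma bump_pieces:
  assumes "a < b" "t \<in> {0..1}"
  shows "a \<le> t \<Longrightarrow> t \<le> a + (b - a) / 4 \<Longrightarrow> bump a b t = 2 * t - a"
    "a + (b - a) / 4 \<le> t \<Longrightarrow> t \<le> a + (b - a) / 2 \<Longrightarrow> bump a b t = t + (b - a) / 4"
    "a + (b - a) / 2 \<le> t \<Longrightarrow> t \<le> b \<Longrightarrow> bump a b t = (t + b) / 2"
proof -
  show "bump a b t = 2 * t - a" if "a \<le> t" "t \<le> a + (b - a) / 4"
  proof -
    have "t \<le> 2 * t - a" "2 * t - a \<le> t + (b - a) / 4" "2 * t - a \<le> (t + b) / 2"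
      using that assms(1) by (simp_all add: field_simps)
    then show ?thesis by (simp only: bump_def restrict_apply'[OF assms(2)] min.absorb1 max.absorb2 min.bounded_iff simp_thms)
  qed
  show "bump a b t = t + (b - a) / 4" if "a + (b - a) / 4 \<le> t" "t \<le> a + (b - a) / 2"
  proof -
    have "t \<le> t + (b - a) / 4" "t + (b - a) / 4 \<le> 2 * t - a" "t + (b - a) / 4 \<le> (t + b) / 2"
      using that assms(1) by (simp_all add: field_simps)
    then show ?thesis by (simp only: bump_def restrict_apply'[OF assms(2)] min.absorb1 min.absorb2 max.absorb2)
  qed
  show "bump a b t = (t + b) / 2" if "a + (b - a) / 2 \<le> t" "t \<le> b"
  proof -
    have "t \<le> (t + b) / 2" "(t + b) / 2 \<le> 2 * t - a" "(t + b) / 2 \<le> t + (b - a) / 4"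
      using that assms(1) by (simp_all add: field_simps)
    then show ?thesis by (simp only: bump_def restrict_apply'[OF assms(2)] min.absorb1 min.absorb2 max.absorb2)
  qed
qed

lemma bump_in_thompson_maps:
  assumes a: "a \<in> dyadics" and b: "b \<in> dyadics" and "a < b" "b \<le> 1"
  shows "bump a b \<in> thompson_maps"
proof (rule thompson_mapsI)
  let ?F = "\<lambda>x. max x (min (2 * x - a) (min (x + (b - a) / 4) ((x + b) / 2)))"
  have eq: "bump a b x = ?F x" if "x \<in> {0..1}" for x
    using that by (simp add: bump_def)
  have "0 \<le> a" using a by (auto simp: dyadics_def)
  show "bump a b \<in> extensional {0..1}" by (simp add: bump_def)
  have "continuous_on {0..1} ?F" by (intro continuous_intros) auto
  then show cont: "continuous_on {0..1} (bump a b)"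
    by (rule continuous_on_eq) (simp add: bump_def)
  show mono: "strict_mono_on {0..1} (bump a b)"
  proof (rule strict_mono_onI)
    fix r s :: real assume rs: "r \<in> {0..1}" "s \<in> {0..1}" "r < s"
    have max: "max p q < max p' q'" and min: "min p q < min p' q'"
      if "p < p'" "q < q'" for p q p' q' :: real
      using that by linarith+
    have "?F r < ?F s" by (intro max min) (use \<open>r < s\<close> in simp_all)
    then show "bump a b r < bump a b s" using rs by (simp only: eq)
  qed
  have ends: "bump a b 0 = 0" "bump a b 1 = 1"
    using bump_eq_self \<open>0 \<le> a\<close> assms by auto
  show "bump a b ` {0..1} = {0..1}"
  proof
    show "bump a b ` {0..1} \<subseteq> {0..1}"
      using strict_mono_on_leD[OF mono, of 0] strict_mono_on_leD[OF mono, of _ 1] ends by fastforce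
    show "{0..1} \<subseteq> bump a b ` {0..1}"
    proof
      fix y :: real assume "y \<in> {0..1}"
      then show "y \<in> bump a b ` {0..1}"
        using IVT'[of "bump a b" 0 y 1] ends cont by auto
    qed
  qed
  let ?p = "a + (b - a) / 4" and ?q = "a + (b - a) / 2"
  have "a \<in> dyadic_ring" "b \<in> dyadic_ring"
    using a b \<open>0 \<le> a\<close> \<open>a < b\<close> dyadics_iff_dyadic_ring by auto
  then have D: "a + 2 powi m * (b - a) \<in> dyadic_ring" for m
    by (intro dyadic_ring_add dyadic_ring_powi_mult dyadic_ring_diff)
  have pq: "?p \<in> dyadics" "?q \<in> dyadics"
    using D[of "-2"] D[of "-1"] \<open>0 \<le> a\<close> \<open>a < b\<close> by (simp_all add: dyadics_iff_dyadic_ring power_int_minus)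
  show "dyadic_piecewise_linear (bump a b)"
    unfolding dyadic_piecewise_linear_def
  proof (intro exI[of _ "{a, ?p, ?q, b}"] conjI allI impI)
    show "finite {a, ?p, ?q, b}" by simp
    show "{a, ?p, ?q, b} \<subseteq> dyadics" using a b pq by simp
    fix x y :: real
    assume xy: "0 \<le> x \<and> x < y \<and> y \<le> 1 \<and> {x<..<y} \<inter> {a, ?p, ?q, b} = {}"
    have out: "y \<le> z \<or> z \<le> x" if "z \<in> {a, ?p, ?q, b}" for z
      using xy that by (metis disjoint_iff greaterThanLessThan_iff not_le)
    have "y \<le> a \<or> a \<le> x" "y \<le> ?p \<or> ?p \<le> x" "y \<le> ?q \<or> ?q \<le> x" "y \<le> b \<or> b \<le> x"
      by (rule out, simp)+
    then consider "y \<le> a \<or> b \<le> x" | "a \<le> x" "y \<le> ?p" | "?p \<le> x" "y \<le> ?q" | "?q \<le> x" "y \<le> b"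
      by blast
    then show "\<exists>(k::int) c. \<forall>t\<in>{x..y}. bump a b t = 2 powi k * t + c"
    proof cases
      case 1
      then have "\<forall>t\<in>{x..y}. bump a b t = 2 powi 0 * t + 0"
        using xy \<open>a < b\<close> by (auto simp: bump_eq_self)
      then show ?thesis by blast
    next
      case 2
      have "bump a b t = 2 * t - a" if "t \<in> {x..y}" for t
        using bump_pieces(1)[of a b t] that 2 xy \<open>a < b\<close> by simp
      then have "\<forall>t\<in>{x..y}. bump a b t = 2 powi 1 * t + (- a)"
        by (simp add: power_int_minus field_simps)
      then show ?thesis by blast
    next
      case 3
      have "bump a b t = t + (b - a) / 4" if "t \<in> {x..y}" for t
        using bump_pieces(2)[of a b t] that 3 xy \<open>a < b\<close> by simp
      then have "\<forall>t\<in>{x..y}. bump a b t = 2 powi 0 * t + (b - a) / 4"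
        by (simp add: power_int_minus field_simps)
      then show ?thesis by blast
    next
      case 4
      have "bump a b t = (t + b) / 2" if "t \<in> {x..y}" for t
        using bump_pieces(3)[of a b t] that 4 xy \<open>a < b\<close> by simp
      then have "\<forall>t\<in>{x..y}. bump a b t = 2 powi (-1) * t + b / 2"
        by (simp add: power_int_minus field_simps)
      then show ?thesis by blast
    qed
  qed
qed

text \<open>
  A bump on a dyadic interval around \<open>x\<close> that avoids \<open>A\<close>.
\<close>

lemma thompson_maps_push_one_point:
  assumes "finite A" "A \<subseteq> {0..1}" "0 < x" "x < 1" "x \<notin> A"
  obtains f where "f \<in> thompson_maps" "x < f x" "\<And>y. y \<in> A \<Longrightarrow> f y = y"
proof -
  obtain e where e: "e > 0" "\<And>y. y \<in> A \<Longrightarrow> e \<le> dist x y"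
  proof (cases "A = {}")
    case True
    then show ?thesis using that[of 1] by simp
  next
    case False
    define e where "e = Min (dist x ` A)"
    have "e \<in> dist x ` A" unfolding e_def using False assms(1) by (intro Min_in) auto
    then have "e > 0" using assms(5) by auto
    moreover have "e \<le> dist x y" if "y \<in> A" for y
      unfolding e_def using that assms(1) by (intro Min_le) auto
    ultimately show ?thesis using that by blast
  qed
  obtain a where a: "a \<in> dyadics" "max 0 (x - e) < a" "a < x"
    using dyadics_dense[of "max 0 (x - e)" x] e assms by auto
  obtain b where b: "b \<in> dyadics" "x < b" "b < min 1 (x + e)"
    using dyadics_dense[of x "min 1 (x + e)"] e assms by auto
  show thesis
  proof
    show "bump a b \<in> thompson_maps" using a b by (intro bump_in_thompson_maps) auto
    show "x < bump a b x" using a b assms by (intro bump_greater) auto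
    fix y assume y: "y \<in> A"
    have "y \<le> a \<or> b \<le> y" using e(2)[OF y] a b by (auto simp: dist_real_def)
    then show "bump a b y = y" using a b y assms by (intro bump_eq_self) auto
  qed
qed

section \<open>Left-orderings from sequences of points\<close>

lemma positive_coneI:
  fixes G (structure)
  assumes "group G" and sub: "P \<subseteq> carrier G"
    and mult: "\<And>f g. f \<in> P \<Longrightarrow> g \<in> P \<Longrightarrow> f \<otimes>\<^bsub>G\<^esub> g \<in> P"
    and one: "\<one>\<^bsub>G\<^esub> \<notin> P"
    and total: "\<And>f. f \<in> carrier G \<Longrightarrow> f \<noteq> \<one>\<^bsub>G\<^esub> \<Longrightarrow> f \<in> P \<or> inv\<^bsub>G\<^esub> f \<in> P"
  shows "positive_cone G P"
proof -
  interpret group G by fact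
  have inv_iff: "f \<in> set_inv P \<longleftrightarrow> f \<in> carrier G \<and> inv f \<in> P" for f
    using sub by (auto simp: SET_INV_def intro!: bexI[of _ "inv f"])
  have "inv f \<notin> P" if "f \<in> P" for f
    using mult[OF that, of "inv f"] one sub that by auto
  moreover have "f \<noteq> \<one>" if "inv f \<in> P" for f
    using that one by auto
  ultimately show ?thesis
    using sub one mult unfolding positive_cone_def
    by (auto simp: set_mult_def inv_iff dest: total)
qed

text \<open>
  The positive cone of a bi-ordering of \<open>F\<close>. It decides about the elements that fix every point of a
  given sequence, for which the lexicographic comparison along the sequence says nothing.
\<close>

definition right_positive :: "(real \<Rightarrow> real) \<Rightarrow> bool" where
  "right_positive f \<longleftrightarrow>
     (\<exists>t u. 0 \<le> t \<and> t < u \<and> u \<le> 1 \<and> (\<forall>x\<in>{0..t}. f x = x) \<and> (\<forall>x\<in>{t<..<u}. x < f x))"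

lemma right_positive_mult:
  assumes f: "f \<in> thompson_maps" and g: "g \<in> thompson_maps"
    and "right_positive f" "right_positive g"
  shows "right_positive (f \<otimes>\<^bsub>thompson_F\<^esub> g)"
proof -
  obtain t u where t: "0 \<le> t" "t < u" "u \<le> 1" "\<And>x. x \<in> {0..t} \<Longrightarrow> f x = x" "\<And>x. x \<in> {t<..<u} \<Longrightarrow> x < f x"
    using assms(3) unfolding right_positive_def by blast
  obtain s v where s: "0 \<le> s" "s < v" "v \<le> 1" "\<And>x. x \<in> {0..s} \<Longrightarrow> g x = x" "\<And>x. x \<in> {s<..<v} \<Longrightarrow> x < g x"
    using assms(4) unfolding right_positive_def by blast
  define r where "r = min t s"
  define w where "w = (if t < s then min u s else if s < t then min v t else min u v)"
  have rw: "0 \<le> r" "r < w" "w \<le> 1" "w \<le> u" "w \<le> v" using t s by (auto simp: r_def w_def)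
  have "(f \<otimes>\<^bsub>thompson_F\<^esub> g) x = x" if "x \<in> {0..r}" for x
    using that t(1-4) s(4) rw by (simp add: thompson_mult_apply[OF f g] r_def)
  moreover have "x < (f \<otimes>\<^bsub>thompson_F\<^esub> g) x" if x: "x \<in> {r<..<w}" for x
  proof -
    have x01: "x \<in> {0..1}" using x rw by auto
    then have gx01: "g x \<in> {0..1}" using thompson_maps_mem[OF g] by simp
    have "x \<le> f x" "x \<le> g x"
      using x x01 rw t(4,5)[of x] s(4,5)[of x] by (cases "x \<le> t"; cases "x \<le> s"; simp)+
    moreover have "x < f x \<or> x < g x"
      using x x01 rw t(5)[of x] s(5)[of x] by (cases "x \<le> t"; cases "x \<le> s"; auto simp: r_def min_less_iff_disj)
    moreover have "f x \<le> f (g x)" using \<open>x \<le> g x\<close> thompson_maps_le_iff[OF f x01 gx01] by simp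
    moreover have "f x < f (g x)" if "x < g x" using that thompson_maps_less_iff[OF f x01 gx01] by simp
    ultimately show ?thesis by (auto simp: thompson_mult_apply[OF f g x01])
  qed
  ultimately show ?thesis unfolding right_positive_def using rw by blast
qed

text \<open>
  The sign is read off at the infimum \<open>t\<close> of the moved points. It is fixed, since \<open>f\<close> is a continuous
  extension of the identity on \<open>[0,t)\<close>; just after \<open>t\<close>, the map is \<open>t + 2^k (x - t)\<close> with \<open>k \<noteq> 0\<close>, and
  the sign of \<open>k\<close> decides.
\<close>

lemma right_positive_total:
  assumes f: "f \<in> thompson_maps" and "f \<noteq> \<one>\<^bsub>thompson_F\<^esub>"
  shows "right_positive f \<or> right_positive (inv\<^bsub>thompson_F\<^esub> f)"
proof -
  let ?S = "{x \<in> {0..1}. f x \<noteq> x}"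
  have "?S \<noteq> {}"
    using thompson_maps_eqI[OF f, of "\<one>\<^bsub>thompson_F\<^esub>"] assms(2) F.one_closed thompson_one_apply by auto
  then obtain z where z: "z \<in> ?S" by blast
  define t where "t = Inf ?S"
  have bdd: "bdd_below ?S" by (rule bdd_belowI[of _ 0]) auto
  have t: "0 \<le> t" "t \<le> z"
    using cInf_greatest[OF \<open>?S \<noteq> {}\<close>, of 0] cInf_lower[OF z bdd] by (auto simp: t_def)
  have fixed: "f x = x" if "0 \<le> x" "x < t" for x
  proof (rule ccontr)
    assume "f x \<noteq> x"
    then have "x \<in> ?S" using that t z by auto
    then have "t \<le> x" unfolding t_def using bdd by (intro cInf_lower)
    then show False using that by simp
  qed
  have t01: "t \<in> {0..1}" using t z by auto
  have "f t = t"
  proof (rule ccontr)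
    assume "f t \<noteq> t"
    then consider "f t < t" | "t < f t" by linarith
    then show False
    proof cases
      case 1
      \<comment> \<open>\<open>x\<close> is a fixed point strictly between \<open>f t\<close> and \<open>t\<close>, against monotonicity.\<close>
      define x where "x = (f t + t) / 2"
      have x: "f t < x" "x < t" "0 \<le> x" using 1 thompson_maps_mem[OF f, of t] t01 by (auto simp: x_def)
      then have "f x < f t" using fixed thompson_maps_less_iff[OF f, of x t] t01 x by auto
      then show False using fixed x by auto
    next
      case 2
      \<comment> \<open>A value in the gap between \<open>t\<close> and \<open>f t\<close> could only be taken at a point before \<open>t\<close>, which is fixed.\<close>
      define y where "y = (f t + t) / 2"
      have y: "t < y" "y < f t" "y \<in> {0..1}" using 2 thompson_maps_mem[OF f, of t] t01 by (auto simp: y_def)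
      obtain w where w: "w \<in> {0..1}" "f w = y" using thompson_maps_surj[OF f y(3)] .
      then have "w < t" using y thompson_maps_less_iff[OF f w(1) t01] by simp
      then show False using fixed[of w] w y by auto
    qed
  qed
  then have fixed': "\<forall>x\<in>{0..t}. f x = x" using fixed by (metis atLeastAtMost_iff order_le_less)
  have "t \<noteq> z" using \<open>f t = t\<close> z by auto
  then have "t < 1" using t z by auto
  then obtain u k where u: "t < u" "u \<le> 1" and k: "\<And>x. x \<in> {t..u} \<Longrightarrow> f x = t + 2 powi k * (x - t)"
    using thompson_maps_affine_right_of_fixed_point[OF f t(1) _ \<open>f t = t\<close>] by metis
  consider "k = 0" | "k > 0" | "k < 0" by linarith
  then show ?thesis
  proof cases
    case 1
    have "u \<le> t" unfolding t_def
    proof (rule cInf_greatest[OF \<open>?S \<noteq> {}\<close>])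
      fix x assume x: "x \<in> ?S"
      show "u \<le> x"
      proof (rule ccontr)
        assume "\<not> u \<le> x"
        then have "f x = x" using fixed' k[of x] 1 x by (cases "x \<le> t") auto
        then show False using x by simp
      qed
    qed
    then show ?thesis using u by simp
  next
    case 2
    then have "(1::real) < 2 powi k" using power_int_strict_increasing[of 0 k "2::real"] by simp
    then have "x < f x" if "x \<in> {t<..<u}" for x
    proof -
      have "x = t + 1 * (x - t)" by simp
      also have "\<dots> < t + 2 powi k * (x - t)"
        by (intro add_strict_left_mono mult_strict_right_mono \<open>1 < 2 powi k\<close>) (use that in simp)
      also have "\<dots> = f x" using k[of x] that by simp
      finally show ?thesis .
    qed
    then show ?thesis using u t fixed' unfolding right_positive_def by blast
  next
    case 3
    then have "2 powi k < (1::real)" using power_int_strict_increasing[of k 0 "2::real"] by simp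
    then have less: "f x < x" if "x \<in> {t<..<u}" for x
    proof -
      have "f x = t + 2 powi k * (x - t)" using k[of x] that by simp
      also have "\<dots> < t + 1 * (x - t)"
        by (intro add_strict_left_mono mult_strict_right_mono \<open>2 powi k < 1\<close>) (use that in simp)
      also have "\<dots> = x" by simp
      finally show ?thesis .
    qed
    let ?g = "inv\<^bsub>thompson_F\<^esub> f"
    have u01: "u \<in> {0..1}" using u t by auto
    have "t < f u" "f u \<le> 1"
      using thompson_maps_less_iff[OF f t01 u01] thompson_maps_mem[OF f, of u] u01 u \<open>f t = t\<close> by auto
    moreover have "\<forall>x\<in>{0..t}. ?g x = x"
      using fixed' thompson_inv_apply(1)[OF f] t01 by force
    moreover have "x < ?g x" if x: "x \<in> {t<..<f u}" for x
    proof -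
      have "x \<in> {0..1}" using x \<open>f u \<le> 1\<close> t by auto
      then obtain y where y: "y \<in> {0..1}" "f y = x" using thompson_maps_surj[OF f] by blast
      have "t < y" "y < u"
        using x y \<open>f t = t\<close> thompson_maps_less_iff[OF f t01 y(1)] thompson_maps_less_iff[OF f y(1) u01] by auto
      then have "f y < y" using less by simp
      then show ?thesis using thompson_inv_apply(1)[OF f y(1)] y by simp
    qed
    ultimately show ?thesis using t unfolding right_positive_def by blast
  qed
qed

text \<open>
  Conjugation by \<open>h\<close> moves the picture along \<open>h\<close>: the witnesses \<open>t < u\<close> become \<open>h t < h u\<close>.
\<close>

lemma right_positive_conj:
  assumes f: "f \<in> thompson_maps" and h: "h \<in> thompson_maps" and "right_positive f"
  shows "right_positive (h \<otimes>\<^bsub>thompson_F\<^esub> f \<otimes>\<^bsub>thompson_F\<^esub> inv\<^bsub>thompson_F\<^esub> h)" (is "right_positive ?c")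
proof -
  obtain t u where t: "0 \<le> t" "t < u" "u \<le> 1" and fixed: "\<And>x. x \<in> {0..t} \<Longrightarrow> f x = x"
    and up: "\<And>x. x \<in> {t<..<u} \<Longrightarrow> x < f x"
    using assms(3) unfolding right_positive_def by blast
  have c: "?c (h x) = h (f x)" if "x \<in> {0..1}" for x
    using that h f thompson_maps_mem[OF h, of x]
    by (simp add: thompson_mult_apply thompson_inv_mem thompson_inv_apply F.m_closed[simplified])
  have tu01: "t \<in> {0..1}" "u \<in> {0..1}" using t by auto
  have "0 \<le> h t" "h t < h u" "h u \<le> 1"
    using t thompson_maps_mem[OF h] thompson_maps_less_iff[OF h tu01] by auto
  moreover have "?c y = y" if y: "y \<in> {0..h t}" for y
  proof -
    have "y \<in> {0..1}" using y thompson_maps_mem[OF h, of t] tu01 by auto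
    then obtain x where x: "x \<in> {0..1}" "h x = y" using thompson_maps_surj[OF h] by blast
    then have "x \<le> t" using y thompson_maps_le_iff[OF h x(1) tu01(1)] by simp
    then show ?thesis using c[OF x(1)] fixed[of x] x by simp
  qed
  moreover have "y < ?c y" if y: "y \<in> {h t<..<h u}" for y
  proof -
    have "y \<in> {0..1}" using y \<open>0 \<le> h t\<close> \<open>h u \<le> 1\<close> by auto
    then obtain x where x: "x \<in> {0..1}" "h x = y" using thompson_maps_surj[OF h] by blast
    then have "t < x" "x < u"
      using y thompson_maps_less_iff[OF h tu01(1) x(1)] thompson_maps_less_iff[OF h x(1) tu01(2)] by auto
    then have "x < f x" using up by simp
    moreover have "f x \<in> {0..1}" using thompson_maps_mem[OF f] x by simp
    ultimately show ?thesis using c[OF x(1)] x thompson_maps_less_iff[OF h x(1)] by simp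
  qed
  ultimately show ?thesis unfolding right_positive_def by blast
qed

lemma not_right_positive_one: "\<not> right_positive \<one>\<^bsub>thompson_F\<^esub>"
proof
  assume "right_positive \<one>\<^bsub>thompson_F\<^esub>"
  then obtain t u where t: "0 \<le> t" "t < u" "u \<le> 1" "\<forall>x\<in>{t<..<u}. x < \<one>\<^bsub>thompson_F\<^esub> x"
    unfolding right_positive_def by blast
  then show False using thompson_one_apply[of "(t + u) / 2"] bspec[OF t(4), of "(t + u) / 2"] by simp
qed

definition point_cone :: "(nat \<Rightarrow> real) \<Rightarrow> (real \<Rightarrow> real) set" where
  "point_cone x = {f \<in> thompson_maps.
     (\<exists>n. (\<forall>m<n. f (x m) = x m) \<and> x n < f (x n)) \<or> (\<forall>n. f (x n) = x n) \<and> right_positive f}"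

text \<open>
  At the first index where \<open>f\<close> or \<open>g\<close> moves its point, neither of them pushes to the left and one of
  them pushes to the right; monotonicity of \<open>f\<close> transfers this to the product.
\<close>

lemma point_cone_mult:
  assumes range: "range x \<subseteq> {0..1}" and "f \<in> point_cone x" "g \<in> point_cone x"
  shows "f \<otimes>\<^bsub>thompson_F\<^esub> g \<in> point_cone x"
proof -
  have x: "x n \<in> {0..1}" for n using range_subsetD[OF range] .
  have f: "f \<in> thompson_maps" and g: "g \<in> thompson_maps" using assms by (auto simp: point_cone_def)
  have fg: "f \<otimes>\<^bsub>thompson_F\<^esub> g \<in> thompson_maps" using F.m_closed f g by simp
  have gx: "g (x n) \<in> {0..1}" for n using thompson_maps_mem[OF g] x[of n] by simp
  note app = thompson_mult_apply[OF f g x]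
  consider (f) n where "\<And>m. m < n \<Longrightarrow> f (x m) = x m" "\<And>m. m < n \<Longrightarrow> g (x m) = x m"
      "x n < f (x n)" "x n \<le> g (x n)"
    | (g) n where "\<And>m. m < n \<Longrightarrow> f (x m) = x m" "\<And>m. m < n \<Longrightarrow> g (x m) = x m"
      "f (x n) = x n" "x n < g (x n)"
    | (none) "\<And>n. f (x n) = x n" "\<And>n. g (x n) = x n" "right_positive f" "right_positive g"
  proof -
    consider (1) i j where "\<forall>m<i. f (x m) = x m" "x i < f (x i)" "\<forall>m<j. g (x m) = x m" "x j < g (x j)"
      | (2) i where "\<forall>m<i. f (x m) = x m" "x i < f (x i)" "\<forall>m. g (x m) = x m"
      | (3) j where "\<forall>m. f (x m) = x m" "\<forall>m<j. g (x m) = x m" "x j < g (x j)"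
      | (4) "\<forall>m. f (x m) = x m" "\<forall>m. g (x m) = x m" "right_positive f" "right_positive g"
      using assms(2,3) by (auto simp: point_cone_def)
    then show thesis
    proof cases
      case (1 i j)
      show thesis
      proof (cases "i \<le> j")
        case True
        then have "x i \<le> g (x i)" using 1 by (cases "i = j") auto
        then show thesis using that(1)[of i] 1 True by auto
      next
        case False
        then show thesis using that(2)[of j] 1 by auto
      qed
    next
      case (2 i)
      then show thesis using that(1)[of i] by auto
    next
      case (3 j)
      then show thesis using that(2)[of j] by auto
    next
      case 4
      then show thesis using that(3) by auto
    qed
  qed
  then show ?thesis
  proof cases
    case (f n)
    have "f (x n) \<le> f (g (x n))"
      using f(4) thompson_maps_le_iff[OF \<open>f \<in> thompson_maps\<close> x gx] by simp
    then have "x n < (f \<otimes>\<^bsub>thompson_F\<^esub> g) (x n)" using f(3) by (simp add: app)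
    moreover have "(f \<otimes>\<^bsub>thompson_F\<^esub> g) (x m) = x m" if "m < n" for m
      using f(1,2)[OF that] by (simp add: app)
    ultimately show ?thesis using fg by (auto simp: point_cone_def)
  next
    case (g n)
    have "f (x n) < f (g (x n))"
      using g(4) thompson_maps_less_iff[OF f x gx] by simp
    then have "x n < (f \<otimes>\<^bsub>thompson_F\<^esub> g) (x n)" using g(3) by (simp add: app)
    moreover have "(f \<otimes>\<^bsub>thompson_F\<^esub> g) (x m) = x m" if "m < n" for m
      using g(1,2)[OF that] by (simp add: app)
    ultimately show ?thesis using fg by (auto simp: point_cone_def)
  next
    case none
    then have "right_positive (f \<otimes>\<^bsub>thompson_F\<^esub> g)" "\<forall>n. (f \<otimes>\<^bsub>thompson_F\<^esub> g) (x n) = x n"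
      using right_positive_mult[OF f g] by (simp_all add: app)
    then show ?thesis using fg by (auto simp: point_cone_def)
  qed
qed

lemma point_cone_total:
  assumes range: "range x \<subseteq> {0..1}" and f: "f \<in> thompson_maps" and "f \<noteq> \<one>\<^bsub>thompson_F\<^esub>"
  shows "f \<in> point_cone x \<or> inv\<^bsub>thompson_F\<^esub> f \<in> point_cone x"
proof -
  have x: "x n \<in> {0..1}" for n using range_subsetD[OF range] .
  let ?g = "inv\<^bsub>thompson_F\<^esub> f"
  have g: "?g \<in> thompson_maps" using thompson_inv_mem[OF f] .
  have fixed: "?g (x n) = x n" if "f (x n) = x n" for n
    using thompson_inv_apply(1)[OF f x[of n]] that by simp
  show ?thesis
  proof (cases "\<forall>n. f (x n) = x n")
    case True
    then show ?thesis
      using right_positive_total[OF f assms(3)] fixed f g by (auto simp: point_cone_def)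
  next
    case False
    have "\<exists>n. f (x n) \<noteq> x n" using False by simp
    then obtain n where n: "f (x n) \<noteq> x n" and "\<forall>m<n. \<not> f (x m) \<noteq> x m"
      by (subst (asm) exists_least_iff) (elim exE conjE)
    then have less_n: "f (x m) = x m" if "m < n" for m using that by simp
    show ?thesis
    proof (cases "x n < f (x n)")
      case True
      then show ?thesis using less_n f by (auto simp: point_cone_def)
    next
      case False
      then have "f (x n) < x n" using n by simp
      moreover have "f (x n) \<in> {0..1}" using thompson_maps_mem[OF f] x[of n] by simp
      ultimately have "x n < ?g (x n)"
        using thompson_maps_less_iff[OF g _ x[of n]] thompson_inv_apply(1)[OF f x[of n]] by metis
      moreover have "\<forall>m<n. ?g (x m) = x m" using less_n fixed by simp
      ultimately have "?g \<in> point_cone x" using g unfolding point_cone_def by blast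
      then show ?thesis ..
    qed
  qed
qed

lemma point_cone_in_LO:
  assumes range: "range x \<subseteq> {0..1}"
  shows "point_cone x \<in> LO thompson_F"
proof -
  have x: "x n \<in> {0..1}" for n using range_subsetD[OF range] .
  have "\<one>\<^bsub>thompson_F\<^esub> \<notin> point_cone x"
    using thompson_one_apply[OF x] not_right_positive_one by (auto simp: point_cone_def)
  then have "positive_cone thompson_F (point_cone x)"
    using point_cone_mult[OF assms] point_cone_total[OF assms]
    by (intro positive_coneI F.is_group) (auto simp: point_cone_def)
  then show ?thesis by (simp add: LO_def)
qed

lemma point_cone_conj:
  assumes range: "range x \<subseteq> {0..1}" and h: "h \<in> thompson_maps" and "f \<in> point_cone x"
  shows "h \<otimes>\<^bsub>thompson_F\<^esub> f \<otimes>\<^bsub>thompson_F\<^esub> inv\<^bsub>thompson_F\<^esub> h \<in> point_cone (h \<circ> x)" (is "?c \<in> _")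
proof -
  have x: "x n \<in> {0..1}" for n using range_subsetD[OF range] .
  have f: "f \<in> thompson_maps" using assms(3) by (simp add: point_cone_def)
  have c: "?c \<in> thompson_maps" using F.m_closed f h thompson_inv_mem[OF h] by simp
  have app: "?c (h (x n)) = h (f (x n))" for n
    using x[of n] h f thompson_maps_mem[OF h, of "x n"]
    by (simp add: thompson_mult_apply thompson_inv_mem thompson_inv_apply F.m_closed[simplified])
  have fx: "f (x n) \<in> {0..1}" for n using thompson_maps_mem[OF f] x[of n] by simp
  have eq: "?c (h (x n)) = h (x n) \<longleftrightarrow> f (x n) = x n" for n
    unfolding app using thompson_maps_eq_iff[OF h fx x] .
  have less: "h (x n) < ?c (h (x n)) \<longleftrightarrow> x n < f (x n)" for n
    unfolding app using thompson_maps_less_iff[OF h x fx] .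
  have "right_positive f \<Longrightarrow> right_positive ?c" by (rule right_positive_conj[OF f h])
  then show ?thesis
    using assms(3) c unfolding point_cone_def mem_Collect_eq comp_apply eq less by blast
qed

text \<open>
  The inclusion \<open>point_cone_conj\<close> for the inverse of \<open>h\<close> yields equality.
\<close>

lemma conj_action_point_cone:
  assumes range: "range x \<subseteq> {0..1}" and h: "h \<in> thompson_maps"
  shows "conj_action thompson_F h (point_cone x) = point_cone (h \<circ> x)"
proof -
  have x: "x n \<in> {0..1}" for n using range_subsetD[OF range] .
  let ?G = thompson_F
  let ?h' = "inv\<^bsub>?G\<^esub> h"
  have h': "?h' \<in> thompson_maps" by (rule thompson_inv_mem[OF h])
  have hx: "range (h \<circ> x) \<subseteq> {0..1}" using thompson_maps_mem[OF h] x by auto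
  have "conj_action ?G h (point_cone x) = (\<lambda>f. h \<otimes>\<^bsub>?G\<^esub> f \<otimes>\<^bsub>?G\<^esub> ?h') ` point_cone x"
    using point_cone_in_LO[OF range] by (auto simp: conj_action_def l_coset_def r_coset_def)
  also have "\<dots> = point_cone (h \<circ> x)"
  proof
    show "(\<lambda>f. h \<otimes>\<^bsub>?G\<^esub> f \<otimes>\<^bsub>?G\<^esub> ?h') ` point_cone x \<subseteq> point_cone (h \<circ> x)"
      using point_cone_conj[OF range h] by blast
    show "point_cone (h \<circ> x) \<subseteq> (\<lambda>f. h \<otimes>\<^bsub>?G\<^esub> f \<otimes>\<^bsub>?G\<^esub> ?h') ` point_cone x"
    proof
      fix f assume f: "f \<in> point_cone (h \<circ> x)"
      then have fF: "f \<in> thompson_maps" by (simp add: point_cone_def)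
      have "?h' \<otimes>\<^bsub>?G\<^esub> f \<otimes>\<^bsub>?G\<^esub> inv\<^bsub>?G\<^esub> ?h' \<in> point_cone (?h' \<circ> (h \<circ> x))"
        by (rule point_cone_conj[OF hx h' f])
      moreover have "?h' \<circ> (h \<circ> x) = x"
        using thompson_inv_apply(1)[OF h x] by (simp add: fun_eq_iff)
      ultimately have "?h' \<otimes>\<^bsub>?G\<^esub> f \<otimes>\<^bsub>?G\<^esub> h \<in> point_cone x"
        using h by simp
      moreover have "f = h \<otimes>\<^bsub>?G\<^esub> (?h' \<otimes>\<^bsub>?G\<^esub> f \<otimes>\<^bsub>?G\<^esub> h) \<otimes>\<^bsub>?G\<^esub> ?h'"
        using h h' fF by (simp add: F.m_assoc F.inv_solve_left F.m_closed[simplified])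
          (simp add: F.m_assoc[symmetric] F.m_closed[simplified])
      ultimately show "f \<in> (\<lambda>f. h \<otimes>\<^bsub>?G\<^esub> f \<otimes>\<^bsub>?G\<^esub> ?h') ` point_cone x" by blast
    qed
  qed
  finally show ?thesis .
qed

text \<open>
  Let \<open>n\<close> be the first index with \<open>x n \<noteq> y n\<close>. Some element of \<open>F\<close> fixes the earlier, common points,
  pushes \<open>x n\<close> to the right and \<open>y n\<close> to the left, so that it belongs to the first cone only.
\<close>

lemma point_cone_eq_imp_eq:
  assumes x: "\<And>n. x n \<in> {0<..<1}" "inj x" and y: "\<And>n. y n \<in> {0<..<1}" "inj y"
    and eq: "point_cone x = point_cone y"
  shows "x = y"
proof -
  have "x n = y n" for n
  proof (induction n rule: less_induct)
    case (less n)
    show ?case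
    proof (rule ccontr)
      assume ne: "x n \<noteq> y n"
      have xI: "x i \<in> {0..1}" and yI: "y i \<in> {0..1}" for i using x(1)[of i] y(1)[of i] by auto
      let ?A = "x ` {..<n}"
      have A: "finite ?A" "?A \<subseteq> {0..1}" "?A = y ` {..<n}"
        using xI less by (blast, blast, force intro!: image_cong)
      have "x n \<notin> ?A" using injD[OF x(2)] by blast
      moreover have "y n \<notin> ?A" using injD[OF y(2)] unfolding A(3) by blast
      ultimately have "x n \<notin> insert (y n) ?A" "y n \<notin> insert (x n) ?A" using ne by auto
      moreover have "finite (insert z ?A)" for z using A(1) by simp
      ultimately obtain f g where f: "f \<in> thompson_maps" "x n < f (x n)" "\<And>z. z \<in> insert (y n) ?A \<Longrightarrow> f z = z"
        and g: "g \<in> thompson_maps" "y n < g (y n)" "\<And>z. z \<in> insert (x n) ?A \<Longrightarrow> g z = z"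
        using thompson_maps_push_one_point[of "insert (y n) ?A" "x n"]
          thompson_maps_push_one_point[of "insert (x n) ?A" "y n"] x(1)[of n] y(1)[of n] A(2)
        by (metis greaterThanLessThan_iff insert_subset xI yI)
      let ?g' = "inv\<^bsub>thompson_F\<^esub> g"
      \<comment> \<open>\<open>f\<close> acts on \<open>x n\<close> and fixes \<open>y n\<close>, and \<open>g\<close> does the opposite.\<close>
      let ?w = "f \<otimes>\<^bsub>thompson_F\<^esub> ?g'"
      have g': "?g' \<in> thompson_maps" by (rule thompson_inv_mem[OF g(1)])
      have w: "?w \<in> thompson_maps" using F.m_closed f(1) g' by simp
      have g'_fix: "?g' z = z" if "z \<in> insert (x n) ?A" for z
      proof -
        have "z \<in> {0..1}" using that A(2) xI by blast
        then show ?thesis using thompson_inv_apply(1)[OF g(1)] g(3)[OF that] by metis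
      qed
      have w_app: "?w z = f (?g' z)" if "z \<in> {0..1}" for z
        using thompson_mult_apply[OF f(1) g' that] .
      have w_fix: "?w (x m) = x m" if "m < n" for m
        using that g'_fix[of "x m"] f(3)[of "x m"] by (simp add: w_app[OF xI])
      have "x n < ?w (x n)" using f(2) g'_fix[of "x n"] by (simp add: w_app[OF xI])
      then have "?w \<in> point_cone y" unfolding eq[symmetric] using w w_fix by (auto simp: point_cone_def)
      moreover have "?w (y n) < y n"
      proof -
        have gy: "g (y n) \<in> {0..1}" using thompson_maps_mem[OF g(1)] yI[of n] by simp
        have "?g' (y n) < y n"
          using g(2) thompson_maps_less_iff[OF g' yI gy] thompson_inv_apply(1)[OF g(1) yI] by metis
        moreover have "?g' (y n) \<in> {0..1}" using thompson_maps_mem[OF g'] yI[of n] by simp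
        ultimately have "f (?g' (y n)) < f (y n)" using thompson_maps_less_iff[OF f(1) _ yI] by blast
        then show ?thesis using f(3)[of "y n"] by (simp add: w_app[OF yI])
      qed
      moreover have "?w (y m) = y m" if "m < n" for m using w_fix[OF that] less[OF that] by simp
      ultimately show False
        unfolding point_cone_def mem_Collect_eq by (metis less_irrefl linorder_neqE_nat order_less_asym)
    qed
  qed
  then show ?thesis by blast
qed

section \<open>Coding binary sequences by left-orderings\<close>

text \<open>
  The two markers of an interval are the points at \<open>1/4\<close> and at \<open>1/2\<close> of \<open>[1/2^(n+1), 1/2^n]\<close>. With this
  choice the bump on the interval maps one exactly to the other, while their ratio \<open>6/5\<close> is not a power
  of \<open>2\<close>.
\<close>

definition marker :: "nat \<Rightarrow> bool \<Rightarrow> real" where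
  "marker n b = (if b then 3 / 2 else 5 / 4) / 2 ^ Suc n"

lemma marker_bounds: "1 / 2 ^ Suc n < marker n b" "marker n b < 1 / 2 ^ n"
  by (auto simp: marker_def field_simps)

lemma marker_less:
  assumes "m < n"
  shows "marker n b < marker m c"
proof -
  have "marker n b < 1 / 2 ^ n" by (rule marker_bounds)
  also have "\<dots> \<le> 1 / 2 ^ Suc m" using assms by (intro divide_left_mono power_increasing) auto
  also have "\<dots> < marker m c" by (rule marker_bounds)
  finally show ?thesis .
qed

lemma marker_in_unit: "marker n b \<in> {0<..<1}"
proof -
  have "0 < marker n b" by (auto simp: marker_def)
  moreover have "marker n b < 1 / 2 ^ n" by (rule marker_bounds)
  moreover have "1 / 2 ^ n \<le> (1::real)" by simp
  ultimately show ?thesis unfolding greaterThanLessThan_iff by linarith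
qed

lemma marker_mem: "marker n b \<in> {0..1}"
  using marker_in_unit[of n b] by simp

lemma markers_tendsto_0:
  assumes "0 < u"
  obtains N where "\<And>n b. N \<le> n \<Longrightarrow> marker n b < u"
proof -
  obtain N where N: "(1/2) ^ N < u" using real_arch_pow_inv[of u "1/2"] assms by auto
  show thesis
  proof
    fix n b assume "N \<le> n"
    have "marker n b < (1/2) ^ n" using marker_bounds(2)[of n b] by (simp add: power_divide)
    also have "\<dots> \<le> (1/2) ^ N" using \<open>N \<le> n\<close> by (intro power_decreasing) auto
    finally show "marker n b < u" using N by simp
  qed
qed

lemma thompson_maps_flip_marker:
  obtains f where "f \<in> thompson_maps" "f (marker n b) = marker n (\<not> b)"
    "\<And>m c. m \<noteq> n \<Longrightarrow> f (marker m c) = marker m c"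
proof -
  let ?a = "1 / 2 ^ Suc n :: real" and ?b = "1 / 2 ^ n :: real"
  let ?h = "bump ?a ?b"
  have "real 1 / 2 ^ k \<in> dyadics" for k unfolding dyadics_def by blast
  then have "?a \<in> dyadics" "?b \<in> dyadics" unfolding of_nat_1 by blast+
  then have h: "?h \<in> thompson_maps"
    by (intro bump_in_thompson_maps) (auto simp: field_simps)
  have push: "?h (marker n False) = marker n True"
    using bump_pieces(1)[of ?a ?b "marker n False"] marker_mem[of n False]
    by (simp add: marker_def field_simps)
  have other: "?h (marker m c) = marker m c" if "m \<noteq> n" for m c
  proof (rule bump_eq_self[OF _ marker_mem])
    note mn = that
    show "?a < ?b" by (simp add: field_simps)
    consider "m < n" | "n < m" using mn by linarith
    then show "marker m c \<le> ?a \<or> ?b \<le> marker m c"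
    proof cases
      case 1
      then have "?b \<le> 1 / 2 ^ Suc m" by (intro divide_left_mono power_increasing) auto
      then show ?thesis using marker_bounds(1)[of m c] by linarith
    next
      case 2
      then have "1 / 2 ^ m \<le> ?a" by (intro divide_left_mono power_increasing) auto
      then show ?thesis using marker_bounds(2)[of m c] by linarith
    qed
  qed
  show thesis
  proof (cases b)
    case False
    then show thesis using that[OF h] push other by simp
  next
    case True
    let ?g = "inv\<^bsub>thompson_F\<^esub> ?h"
    have "?g (marker n b) = marker n (\<not> b)"
      using thompson_inv_apply(1)[OF h marker_mem[of n False]] push True by simp
    moreover have "?g (marker m c) = marker m c" if "m \<noteq> n" for m c
      using thompson_inv_apply(1)[OF h marker_mem[of m c]] other[OF that] by simp
    ultimately show thesis using that[OF thompson_inv_mem[OF h]] by blast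
  qed
qed

text \<open>
  Finitely many flips are composed one at a time.
\<close>

lemma thompson_maps_move_markers:
  assumes "finite {n. \<alpha> n \<noteq> \<beta> n}"
  shows "\<exists>h\<in>thompson_maps. \<forall>n. h (marker n (\<alpha> n)) = marker n (\<beta> n)"
  using assms
proof (induction "{n. \<alpha> n \<noteq> \<beta> n}" arbitrary: \<beta> rule: finite_induct)
  case empty
  then have "\<alpha> = \<beta>" by auto
  then show ?case
    using F.one_closed thompson_one_apply[OF marker_mem] by (intro bexI[of _ "\<one>\<^bsub>thompson_F\<^esub>"]) simp_all
next
  case (insert i N)
  let ?\<beta> = "\<beta>(i := \<not> \<beta> i)"
  have "N = {n. \<alpha> n \<noteq> ?\<beta> n}" using insert(2,4) by (auto simp: set_eq_iff)
  then obtain h where h: "h \<in> thompson_maps" "\<And>n. h (marker n (\<alpha> n)) = marker n (?\<beta> n)"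
    using insert(3) by blast
  obtain f where f: "f \<in> thompson_maps" "f (marker i (\<not> \<beta> i)) = marker i (\<beta> i)"
    "\<And>m c. m \<noteq> i \<Longrightarrow> f (marker m c) = marker m c"
    using thompson_maps_flip_marker[of i "\<not> \<beta> i"] by auto
  have "(f \<otimes>\<^bsub>thompson_F\<^esub> h) (marker n (\<alpha> n)) = marker n (\<beta> n)" for n
    using h(2)[of n] f(2,3) by (simp add: thompson_mult_apply[OF f(1) h(1) marker_mem])
  moreover have "f \<otimes>\<^bsub>thompson_F\<^esub> h \<in> thompson_maps" using F.m_closed f(1) h(1) by simp
  ultimately show ?case by blast
qed

lemma thompson_maps_near_0:
  assumes f: "f \<in> thompson_maps"
  obtains N k where "\<And>n b. N \<le> n \<Longrightarrow> f (marker n b) = 2 powi k * marker n b"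
proof -
  obtain u k where u: "0 < u" and k: "\<And>x. x \<in> {0..u} \<Longrightarrow> f x = 0 + 2 powi k * (x - 0)"
    using thompson_maps_affine_right_of_fixed_point[OF f, of 0] thompson_maps_0[OF f] by (metis order_refl zero_less_one)
  obtain N where N: "\<And>n b. N \<le> n \<Longrightarrow> marker n b < u" using markers_tendsto_0[OF u] by blast
  show thesis
  proof
    fix n b assume "N \<le> n"
    then show "f (marker n b) = 2 powi k * marker n b"
      using k[of "marker n b"] N[of n b] marker_mem[of n b] by simp
  qed
qed

lemma thompson_maps_move_markers_imp_finite:
  assumes h: "h \<in> thompson_maps" and eq: "\<And>n. h (marker n (\<alpha> n)) = marker n (\<beta> n)"
  shows "finite {n. \<alpha> n \<noteq> \<beta> n}"
proof -
  obtain N k where k: "\<And>n b. N \<le> n \<Longrightarrow> h (marker n b) = 2 powi k * marker n b"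
    using thompson_maps_near_0[OF h] by blast
  have "\<alpha> n = \<beta> n" if "N \<le> n" for n
  proof (rule ccontr)
    assume "\<alpha> n \<noteq> \<beta> n"
    then have ratio: "2 powi k = (6 / 5 :: real) \<or> 2 powi k = (5 / 6 :: real)"
      using k[OF that, of "\<alpha> n"] eq[of n] by (cases "\<alpha> n"; cases "\<beta> n") (auto simp: marker_def field_simps)
    consider "k = 0" | "k \<ge> 1" | "k \<le> -1" by linarith
    then show False
    proof cases
      case 2
      then have "2 powi 1 \<le> (2 powi k :: real)" by (intro power_int_increasing) auto
      then show False using ratio by auto
    next
      case 3
      then have "2 powi k \<le> (2 powi (-1) :: real)" by (intro power_int_increasing) auto
      then show False using ratio by (auto simp: power_int_minus)
    qed (use ratio in auto)
  qed
  then have "{n. \<alpha> n \<noteq> \<beta> n} \<subseteq> {..<N}" by (auto simp: not_le[symmetric])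
  then show ?thesis using finite_subset by blast
qed

definition marked_cone :: "(nat \<Rightarrow> bool) \<Rightarrow> (real \<Rightarrow> real) set" where
  "marked_cone \<alpha> = point_cone (\<lambda>n. marker n (\<alpha> n))"

lemma inj_marker_seq: "inj (\<lambda>n. marker n (\<alpha> n))"
  by (rule injI) (metis marker_less less_irrefl linorder_neqE_nat)

lemma E_lo_marked_cone_iff:
  "(marked_cone \<alpha>, marked_cone \<beta>) \<in> E_lo thompson_F \<longleftrightarrow> finite {n. \<alpha> n \<noteq> \<beta> n}"
proof -
  let ?x = "\<lambda>\<gamma> n. marker n (\<gamma> n)"
  have x: "?x \<gamma> n \<in> {0..1}" for \<gamma> n by (rule marker_mem)
  have range: "range (?x \<gamma>) \<subseteq> {0..1}" for \<gamma> using x by blast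
  have "(marked_cone \<alpha>, marked_cone \<beta>) \<in> E_lo thompson_F \<longleftrightarrow>
      (\<exists>h\<in>thompson_maps. point_cone (h \<circ> ?x \<alpha>) = point_cone (?x \<beta>))"
    using point_cone_in_LO[OF range] conj_action_point_cone[OF range]
    by (auto simp: E_lo_def marked_cone_def orbit_def) metis
  also have "\<dots> \<longleftrightarrow> (\<exists>h\<in>thompson_maps. h \<circ> ?x \<alpha> = ?x \<beta>)"
  proof (intro bex_cong refl iffI)
    fix h assume h: "h \<in> thompson_maps" and eq: "point_cone (h \<circ> ?x \<alpha>) = point_cone (?x \<beta>)"
    have "(h \<circ> ?x \<alpha>) n \<in> {0<..<1}" for n
    proof -
      have "h 0 < h (marker n (\<alpha> n))" "h (marker n (\<alpha> n)) < h 1" "h 1 \<le> 1"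
        using thompson_maps_less_iff[OF h] thompson_maps_mem[OF h] marker_in_unit[of n "\<alpha> n"] by auto
      then show ?thesis using thompson_maps_0[OF h] by simp
    qed
    moreover have "inj (h \<circ> ?x \<alpha>)"
      using inj_marker_seq[of \<alpha>] thompson_maps_eq_iff[OF h x x] by (simp add: inj_def)
    ultimately show "h \<circ> ?x \<alpha> = ?x \<beta>"
      using point_cone_eq_imp_eq[OF _ _ marker_in_unit inj_marker_seq eq] by blast
  qed simp
  also have "\<dots> \<longleftrightarrow> finite {n. \<alpha> n \<noteq> \<beta> n}"
    using thompson_maps_move_markers[of \<alpha> \<beta>] thompson_maps_move_markers_imp_finite[of _ \<alpha> \<beta>]
    by (auto simp: fun_eq_iff)
  finally show ?thesis .
qed

lemma two_powi_eq_one_iff: "(2::real) powi k = 1 \<longleftrightarrow> k = 0"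
  using power_int_strict_increasing[of 0 k "2::real"] power_int_strict_increasing[of k 0 "2::real"]
  by (cases k "0::int" rule: linorder_cases) auto

text \<open>
  From some index \<open>N\<close> on, \<open>f\<close> is multiplication by \<open>2^k\<close> on all markers. If \<open>k = 0\<close>, the choices from \<open>N\<close>
  on do not matter because both markers are fixed. If \<open>k \<noteq> 0\<close>, every choice at \<open>N\<close> is moved, so that
  the sign is decided at index \<open>N\<close> at the latest.
\<close>

lemma marked_cone_locally_constant:
  assumes f: "f \<in> thompson_maps"
  obtains N where "\<And>\<alpha> \<beta>. (\<And>m. m < N \<Longrightarrow> \<alpha> m = \<beta> m) \<Longrightarrow> f \<in> marked_cone \<alpha> \<Longrightarrow> f \<in> marked_cone \<beta>"
proof -
  obtain N k where k: "\<And>n b. N \<le> n \<Longrightarrow> f (marker n b) = 2 powi k * marker n b"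
    using thompson_maps_near_0[OF f] by blast
  have pos: "0 < marker n b" for n b using marker_in_unit[of n b] by simp
  have fixed_iff: "f (marker n b) = marker n b \<longleftrightarrow> k = 0" if "N \<le> n" for n b
    using k[OF that, of b] pos[of n b] two_powi_eq_one_iff by auto
  show thesis
  proof
    fix \<alpha> \<beta> assume agree: "\<And>m. m < Suc N \<Longrightarrow> \<alpha> m = \<beta> m" and "f \<in> marked_cone \<alpha>"
    then consider (moved) n where "\<And>m. m < n \<Longrightarrow> f (marker m (\<alpha> m)) = marker m (\<alpha> m)"
        "marker n (\<alpha> n) < f (marker n (\<alpha> n))"
      | (fixed) "\<And>n. f (marker n (\<alpha> n)) = marker n (\<alpha> n)" "right_positive f"
      unfolding marked_cone_def point_cone_def by blast
    then show "f \<in> marked_cone \<beta>"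
    proof cases
      case (moved n)
      have "n \<le> N"
      proof (rule ccontr)
        assume "\<not> n \<le> N"
        then have "k = 0" using moved(1)[of N] fixed_iff[of N] by simp
        then show False using moved(2) fixed_iff[of n] \<open>\<not> n \<le> N\<close> by simp
      qed
      then have "\<And>m. m < n \<Longrightarrow> f (marker m (\<beta> m)) = marker m (\<beta> m)" "marker n (\<beta> n) < f (marker n (\<beta> n))"
        using moved agree by auto
      then show ?thesis using f by (auto simp: marked_cone_def point_cone_def)
    next
      case fixed
      have "f (marker n (\<beta> n)) = marker n (\<beta> n)" for n
      proof (cases "n < Suc N")
        case True
        then show ?thesis using fixed(1)[of n] agree by simp
      next
        case False
        then show ?thesis using fixed(1)[of N] fixed_iff[of N] fixed_iff[of n] by simp
      qed
      then show ?thesis using f fixed(2) by (auto simp: marked_cone_def point_cone_def)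
    qed
  qed
qed

lemma continuous_map_marked_cone:
  "continuous_map euclidean (LO_topology thompson_F) marked_cone"
proof -
  let ?e = "\<lambda>P. \<lambda>g\<in>carrier thompson_F. g \<in> P"
  have "continuous_map euclidean (discrete_topology UNIV) (\<lambda>\<alpha>. f \<in> marked_cone \<alpha>)"
    if f: "f \<in> thompson_maps" for f
  proof -
    obtain N where N: "\<And>\<alpha> \<beta>. (\<And>m. m < N \<Longrightarrow> \<alpha> m = \<beta> m) \<Longrightarrow> f \<in> marked_cone \<alpha> \<Longrightarrow> f \<in> marked_cone \<beta>"
      using marked_cone_locally_constant[OF f] by blast
    have "open {\<alpha>. (f \<in> marked_cone \<alpha>) \<in> V}" for V
    proof (rule topological_space_class.openI)
      fix \<alpha> assume \<alpha>: "\<alpha> \<in> {\<alpha>. (f \<in> marked_cone \<alpha>) \<in> V}"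
      let ?T = "\<Inter>m\<in>{..<N}. (\<lambda>\<beta>. \<beta> m) -` {\<alpha> m} :: (nat \<Rightarrow> bool) set"
      have "open ?T"
        by (intro open_INT finite_lessThan ballI open_vimage continuous_on_product_coordinates)
          (rule discrete_topology_class.open_discrete)
      moreover have "?T \<subseteq> {\<alpha>. (f \<in> marked_cone \<alpha>) \<in> V}"
      proof
        fix \<beta> assume "\<beta> \<in> ?T"
        then have "\<And>m. m < N \<Longrightarrow> \<alpha> m = \<beta> m" by auto
        then have "f \<in> marked_cone \<alpha> \<longleftrightarrow> f \<in> marked_cone \<beta>" using N by metis
        then show "\<beta> \<in> {\<alpha>. (f \<in> marked_cone \<alpha>) \<in> V}" using \<alpha> by simp
      qed
      ultimately show "\<exists>T. open T \<and> \<alpha> \<in> T \<and> T \<subseteq> {\<alpha>. (f \<in> marked_cone \<alpha>) \<in> V}"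
        by (intro exI[of _ ?T]) auto
    qed
    then show ?thesis by (simp add: continuous_map_def)
  qed
  then have "continuous_map euclidean
      (product_topology (\<lambda>_. discrete_topology UNIV) (carrier thompson_F)) (?e \<circ> marked_cone)"
    by (auto simp: continuous_map_componentwise)
  then show ?thesis
    unfolding LO_topology_def
    by (rule continuous_map_pullback')
      (auto simp: marked_cone_def intro!: point_cone_in_LO marker_mem[simplified])
qed

section \<open>Non-smoothness\<close>

theorem theorem1p2:
  shows "\<not> smooth TYPE('y) (LO_topology thompson_F) (E_lo thompson_F)"
  by (rule not_smooth_if_reduces_E0[OF continuous_map_marked_cone E_lo_marked_cone_iff])

end
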